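(* Every finite abelian processor can be emulated by a finite, directed acyclic abelian network whose nodes are adders, splitters, topplers, delayers and presinks.
   Context: $\mathbb{N}=\{0,1,2,\dots\}$. A processor with finite input alphabet $A$, finite output alphabet $B$ and finite state space $Q$ consists of transition maps $t_i:Q\to Q$ and output maps $o_i:Q\to\mathbb{N}^B$ ($i\in A$): on receiving letter $i$ in state $q$ it moves to $t_i(q)$ and emits $(o_i(q))_b$ copies of letter $b$ for each $b\in B$. It is abelian if $t_it_j=t_jt_i$ and $o_i+o_j\circ t_i=o_j+o_i\circ t_j$ for all $i,j\in A$. Every processor comes with an initial state $q^0$ from which every state is reachable by a finite composition of transition maps. It computes $F:\mathbb{N}^A\to\mathbb{N}^B$, where $F(\mathbf{x})$ is the total output produced when, starting from $q^0$, it receives $x_a$ letters $a$ for each $a\in A$ (in any order; the result is order-independent). An abelian network is a finite directed multigraph with pairwise disjoint sets of dangling input edges (no tail), output edges and trash edges (no head); each node carries a finite abelian processor (with an initial state) whose input alphabet is the set of incoming edges and output alphabet the set of outgoing edges. Given letters on the input edges, the network repeatedly picks any non-output, non-trash edge carrying a letter and feeds one letter to the processor at its head, which changes state and places its emitted letters on its outgoing edges; it halts when all letters lie on output or trash edges. Halting and the final output do not depend on the choices; a network halting on all inputs computes a function $\mathbb{N}^{\text{inputs}}\to\mathbb{N}^{\text{outputs}}$, and it emulates a processor if it computes the same function (identifying input/output edges with input/output letters). It is directed acyclic if its graph has no directed cycle. Gates (each may start in any of its states): an adder has one state, two inputs and one output and emits one letter for each letter received, computing $(x,y)\mapsto x+y$;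 a splitter has one state, one input and two outputs and emits one letter on each output per letter received, computing $x\mapsto(x,x)$; for an integer $\lambda\ge2$, a $\lambda$-toppler has one input, one output and states $0,\dots,\lambda-1$: a letter received in state $q<\lambda-1$ moves it to $q+1$ emitting nothing, and a letter received in state $\lambda-1$ moves it to $0$ emitting one letter (from state $q$ it computes $x\mapsto\lfloor (x+q)/\lambda\rfloor$; it is unprimed if started in $0$, primed otherwise); a delayer has states $0,1$: in state $0$ a letter moves it to state $1$ emitting nothing, in state $1$ it emits one letter per letter received (from $0$ it computes $x\mapsto\max(x-1,0)$); a presink has states $0,1$: in state $0$ a letter moves it to state $1$ and it emits one letter, and in state $1$ all letters are ignored (from $0$ it computes $x\mapsto\min(x,1)$).
   Formalization: Processors with an empty input alphabet and a non-empty output alphabet are excluded: every gate has an input, so a finite acyclic gate network without input edges has no nodes and hence no output edges. *)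

theory Defs
  imports Main
begin

section \<open>Processors\<close>

text \<open>
  Alphabets and state spaces are carrier sets, so that they may be empty or have size depending
  on a parameter. Values of \<open>trans\<close> and \<open>emit\<close> outside the carriers carry no meaning.
  \<open>emit P i q b\<close> is the number of letters \<open>b\<close> emitted on receiving \<open>i\<close> in state \<open>q\<close>.
\<close>

record ('a, 'b, 'q) processor =
  in_letters :: "'a set"
  out_letters :: "'b set"
  states :: "'q set"
  init :: 'q
  trans :: "'a \<Rightarrow> 'q \<Rightarrow> 'q"
  emit :: "'a \<Rightarrow> 'q \<Rightarrow> 'b \<Rightarrow> nat"

definition finite_processor :: "('a, 'b, 'q) processor \<Rightarrow> bool" where
  "finite_processor P \<longleftrightarrow>
     finite (in_letters P) \<and> finite (out_letters P) \<and> finite (states P) \<and>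
     init P \<in> states P \<and>
     (\<forall>i\<in>in_letters P. \<forall>q\<in>states P. trans P i q \<in> states P)"

definition abelian :: "('a, 'b, 'q) processor \<Rightarrow> bool" where
  "abelian P \<longleftrightarrow>
     (\<forall>i\<in>in_letters P. \<forall>j\<in>in_letters P. \<forall>q\<in>states P.
        trans P i (trans P j q) = trans P j (trans P i q) \<and>
        (\<forall>b\<in>out_letters P.
           emit P i q b + emit P j (trans P i q) b = emit P j q b + emit P i (trans P j q) b))"

definition accessible :: "('a, 'b, 'q) processor \<Rightarrow> bool" where
  "accessible P \<longleftrightarrow>
     (\<forall>q\<in>states P. \<exists>w. set w \<subseteq> in_letters P \<and> fold (trans P) w (init P) = q)"

primrec word_output :: "('a, 'b, 'q) processor \<Rightarrow> 'q \<Rightarrow> 'a list \<Rightarrow> 'b \<Rightarrow> nat" where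
  "word_output P q [] = (\<lambda>b. 0)"
| "word_output P q (i # w) = (\<lambda>b. emit P i q b + word_output P (trans P i q) w b)"

text \<open>
  The letters may be fed in any order, so every word with the prescribed letter counts must
  produce the output \<open>F x\<close>. This determines \<open>F x b\<close> for \<open>b\<close> in the output alphabet.
\<close>

definition processor_computes ::
    "('a, 'b, 'q) processor \<Rightarrow> (('a \<Rightarrow> nat) \<Rightarrow> ('b \<Rightarrow> nat)) \<Rightarrow> bool" where
  "processor_computes P F \<longleftrightarrow>
     (\<forall>x w. set w \<subseteq> in_letters P \<and> (\<forall>a\<in>in_letters P. count_list w a = x a) \<longrightarrow>
        (\<forall>b\<in>out_letters P. F x b = word_output P (init P) w b))"


section \<open>Abelian networks\<close>

text \<open>
  Edges are named objects, so parallel edges and loops are allowed. \<open>tail N e\<close> is meaningful only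
  for non-input edges, \<open>head N e\<close> only for edges that are neither output nor trash edges.
\<close>

record ('v, 'e, 's) network =
  nodes :: "'v set"
  edges :: "'e set"
  inputs :: "'e set"
  outputs :: "'e set"
  trash :: "'e set"
  tail :: "'e \<Rightarrow> 'v"
  head :: "'e \<Rightarrow> 'v"
  proc :: "'v \<Rightarrow> ('e, 'e, 's) processor"

definition headed_edges :: "('v, 'e, 's) network \<Rightarrow> 'e set" where
  "headed_edges N = edges N - (outputs N \<union> trash N)"

definition tailed_edges :: "('v, 'e, 's) network \<Rightarrow> 'e set" where
  "tailed_edges N = edges N - inputs N"

definition in_edges :: "('v, 'e, 's) network \<Rightarrow> 'v \<Rightarrow> 'e set" where
  "in_edges N v = {e \<in> headed_edges N. head N e = v}"

definition out_edges :: "('v, 'e, 's) network \<Rightarrow> 'v \<Rightarrow> 'e set" where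
  "out_edges N v = {e \<in> tailed_edges N. tail N e = v}"

text \<open>
  The node processors are not required to be \<open>accessible\<close>: a delayer or a presink is allowed to
  start in state 1, from which its state 0 cannot be reached.
\<close>

definition abelian_network :: "('v, 'e, 's) network \<Rightarrow> bool" where
  "abelian_network N \<longleftrightarrow>
     finite (nodes N) \<and> finite (edges N) \<and>
     inputs N \<subseteq> edges N \<and> outputs N \<subseteq> edges N \<and> trash N \<subseteq> edges N \<and>
     inputs N \<inter> outputs N = {} \<and> inputs N \<inter> trash N = {} \<and> outputs N \<inter> trash N = {} \<and>
     (\<forall>e\<in>tailed_edges N. tail N e \<in> nodes N) \<and>
     (\<forall>e\<in>headed_edges N. head N e \<in> nodes N) \<and>
     (\<forall>v\<in>nodes N. finite_processor (proc N v) \<and> abelian (proc N v) \<and>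
        in_letters (proc N v) = in_edges N v \<and> out_letters (proc N v) = out_edges N v)"

definition directed_acyclic :: "('v, 'e, 's) network \<Rightarrow> bool" where
  "directed_acyclic N \<longleftrightarrow>
     acyclic {(tail N e, head N e) | e. e \<in> tailed_edges N \<inter> headed_edges N}"

text \<open>A configuration gives the number of letters on each edge and the state of each node.\<close>

type_synonym ('v, 'e, 's) config = "('e \<Rightarrow> nat) \<times> ('v \<Rightarrow> 's)"

definition initial_config ::
    "('v, 'e, 's) network \<Rightarrow> ('e \<Rightarrow> nat) \<Rightarrow> ('v, 'e, 's) config" where
  "initial_config N x = ((\<lambda>e. if e \<in> inputs N then x e else 0), (\<lambda>v. init (proc N v)))"

definition fire ::
    "('v, 'e, 's) network \<Rightarrow> 'e \<Rightarrow> ('v, 'e, 's) config \<Rightarrow> ('v, 'e, 's) config" where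
  "fire N e c =
     (let m = fst c; s = snd c; v = head N e in
       (\<lambda>f. (if f = e then m f - 1 else m f) +
            (if f \<in> out_edges N v then emit (proc N v) e (s v) f else 0),
        s(v := trans (proc N v) e (s v))))"

definition step :: "('v, 'e, 's) network \<Rightarrow> ('v, 'e, 's) config \<Rightarrow> ('v, 'e, 's) config \<Rightarrow> bool" where
  "step N c c' \<longleftrightarrow> (\<exists>e\<in>headed_edges N. fst c e > 0 \<and> c' = fire N e c)"

definition halted :: "('v, 'e, 's) network \<Rightarrow> ('v, 'e, 's) config \<Rightarrow> bool" where
  "halted N c \<longleftrightarrow> (\<forall>e\<in>headed_edges N. fst c e = 0)"

definition halts_on :: "('v, 'e, 's) network \<Rightarrow> ('e \<Rightarrow> nat) \<Rightarrow> bool" where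
  "halts_on N x \<longleftrightarrow>
     \<not> (\<exists>r :: nat \<Rightarrow> ('v, 'e, 's) config. r 0 = initial_config N x \<and> (\<forall>k. step N (r k) (r (Suc k))))"

text \<open>Both halting and the final output are required for every choice of the letters processed.\<close>

definition network_computes ::
    "('v, 'e, 's) network \<Rightarrow> (('e \<Rightarrow> nat) \<Rightarrow> ('e \<Rightarrow> nat)) \<Rightarrow> bool" where
  "network_computes N G \<longleftrightarrow>
     (\<forall>x. halts_on N x \<and>
        (\<forall>c. (step N)\<^sup>*\<^sup>* (initial_config N x) c \<and> halted N c \<longrightarrow>
           (\<forall>e\<in>outputs N. fst c e = G x e)))"

text \<open>
  \<open>\<iota>\<close> and \<open>\<omega>\<close> identify input and output letters with input and output edges.
\<close>

definition emulates :: "('v, 'e, 's) network \<Rightarrow> ('a, 'b, 'q) processor \<Rightarrow> bool" where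
  "emulates N P \<longleftrightarrow>
     (\<exists>\<iota> \<omega> F G. bij_betw \<iota> (in_letters P) (inputs N) \<and> bij_betw \<omega> (out_letters P) (outputs N) \<and>
        processor_computes P F \<and> network_computes N G \<and>
        (\<forall>x. \<forall>b\<in>out_letters P. G x (\<omega> b) = F (x \<circ> \<iota>) b))"


section \<open>Gates\<close>

definition is_adder :: "('a, 'b, nat) processor \<Rightarrow> bool" where
  "is_adder P \<longleftrightarrow>
     (\<exists>i j b. i \<noteq> j \<and> in_letters P = {i, j} \<and> out_letters P = {b} \<and>
        states P = {0} \<and> init P = 0 \<and>
        (\<forall>k\<in>{i, j}. trans P k 0 = 0 \<and> emit P k 0 b = 1))"

definition is_splitter :: "('a, 'b, nat) processor \<Rightarrow> bool" where
  "is_splitter P \<longleftrightarrow>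
     (\<exists>i b c. b \<noteq> c \<and> in_letters P = {i} \<and> out_letters P = {b, c} \<and>
        states P = {0} \<and> init P = 0 \<and>
        trans P i 0 = 0 \<and> emit P i 0 b = 1 \<and> emit P i 0 c = 1)"

definition is_toppler :: "('a, 'b, nat) processor \<Rightarrow> bool" where
  "is_toppler P \<longleftrightarrow>
     (\<exists>l\<ge>2. \<exists>i b. in_letters P = {i} \<and> out_letters P = {b} \<and>
        states P = {..<l} \<and> init P \<in> {..<l} \<and>
        (\<forall>q<l - 1. trans P i q = q + 1 \<and> emit P i q b = 0) \<and>
        trans P i (l - 1) = 0 \<and> emit P i (l - 1) b = 1)"

definition is_delayer :: "('a, 'b, nat) processor \<Rightarrow> bool" where
  "is_delayer P \<longleftrightarrow>
     (\<exists>i b. in_letters P = {i} \<and> out_letters P = {b} \<and>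
        states P = {0, 1} \<and> init P \<in> {0, 1} \<and>
        trans P i 0 = 1 \<and> emit P i 0 b = 0 \<and>
        trans P i 1 = 1 \<and> emit P i 1 b = 1)"

definition is_presink :: "('a, 'b, nat) processor \<Rightarrow> bool" where
  "is_presink P \<longleftrightarrow>
     (\<exists>i b. in_letters P = {i} \<and> out_letters P = {b} \<and>
        states P = {0, 1} \<and> init P \<in> {0, 1} \<and>
        trans P i 0 = 1 \<and> emit P i 0 b = 1 \<and>
        trans P i 1 = 1 \<and> emit P i 1 b = 0)"

definition is_gate :: "('a, 'b, nat) processor \<Rightarrow> bool" where
  "is_gate P \<longleftrightarrow>
     is_adder P \<or> is_splitter P \<or> is_toppler P \<or> is_delayer P \<or> is_presink P"

text \<open>
  Every gate has an input, so in a finite acyclic network of gates without input edges there are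
  no nodes and hence no output edges. A processor whose input alphabet is empty but whose output
  alphabet is not can therefore not be emulated; this degenerate case has to be excluded.
\<close>

definition nondegenerate :: "('a, 'b, 'q) processor \<Rightarrow> bool" where
  "nondegenerate P \<longleftrightarrow> (in_letters P = {} \<longrightarrow> out_letters P = {})"

end

theory Submission
  imports Defs "HOL-Library.Multiset" "HOL-Library.FuncSet"
begin

text \<open>
  Each output count of a finite abelian processor is a monotone function \<open>F\<close> of the input counts
  whose unit increments are bounded and which, for each input \<open>k\<close>, satisfies
  \<open>F (x + N e\<^sub>k) = F x + d\<close> once \<open>x\<^sub>k \<ge> N\<close>, with \<open>d\<close> independent of \<open>x\<close>. Such an \<open>F\<close> is composed
  from gates by induction on the number of inputs. Hermite's identity
  \<open>F = (\<Sum>j<m. (F + j) div m)\<close> allows replacing \<open>F\<close> by a function \<open>G\<close> that, as a function of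
  \<open>x\<^sub>k\<close> alone, rises by at most \<open>1\<close> during its transient and then is either constant or rises by
  exactly \<open>1\<close> per period. For a function \<open>g\<close> of one variable of this kind, \<open>g n\<close> is recovered
  by rounding sums of \<open>n\<close> and of finitely many values \<open>g s\<close>; applied in the variable \<open>x\<^sub>k\<close>,
  these values are functions of the remaining inputs.

  A composition of gates is turned into a network by attaching gates to output edges one at a
  time. Termination and the final output follow by counting the letters taken from each edge:
  these counts never exceed the totals predicted by the gate functions.
\<close>

section \<open>Functions built from gates\<close>

text \<open>Splitters have no rule: a function may reuse its arguments freely, and copies are made
  only when it is realized by a network. Delayers and presinks start in state 0, topplers in any
  state.\<close>

inductive gate_fun :: "'a set \<Rightarrow> (('a \<Rightarrow> nat) \<Rightarrow> nat) \<Rightarrow> bool" for A where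
  proj: "a \<in> A \<Longrightarrow> gate_fun A (\<lambda>x. x a)"
| add: "gate_fun A f \<Longrightarrow> gate_fun A g \<Longrightarrow> gate_fun A (\<lambda>x. f x + g x)"
| toppler: "gate_fun A f \<Longrightarrow> 2 \<le> l \<Longrightarrow> q < l \<Longrightarrow> gate_fun A (\<lambda>x. (f x + q) div l)"
| delayer: "gate_fun A f \<Longrightarrow> gate_fun A (\<lambda>x. f x - 1)"
| presink: "gate_fun A f \<Longrightarrow> gate_fun A (\<lambda>x. min (f x) 1)"

text \<open>A presink lets through at most one letter, and a delayer then swallows it.\<close>

lemma gate_fun_zero:
  assumes "A \<noteq> {}"
  shows "gate_fun A (\<lambda>x. 0)"
proof -
  obtain a where "a \<in> A" using assms by blast
  then have "gate_fun A (\<lambda>x. min (x a) 1 - 1)"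
    by (intro gate_fun.intros)
  moreover have "(\<lambda>x. min (x a) 1 - 1 :: nat) = (\<lambda>x. 0)" by (auto simp: fun_eq_iff)
  ultimately show ?thesis by simp
qed

lemma gate_fun_at_zero: "gate_fun A f \<Longrightarrow> f (\<lambda>a. 0) = 0"
  by (induction rule: gate_fun.induct) auto

lemma gate_fun_reindex: "gate_fun A f \<Longrightarrow> gate_fun (\<iota> ` A) (\<lambda>x. f (x \<circ> \<iota>))"
  by (induction rule: gate_fun.induct) (auto intro: gate_fun.intros gate_fun.delayer[simplified] gate_fun.presink[simplified])

section \<open>Gate functions up to an additive constant\<close>

text \<open>Gate functions vanish at zero, whereas fixing one variable at a positive value yields
  functions that need not. The induction on the number of inputs therefore carries an additive
  constant, removed at the end by evaluating at zero.\<close>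

definition affine_gate_fun :: "'a set \<Rightarrow> (('a \<Rightarrow> nat) \<Rightarrow> nat) \<Rightarrow> bool" where
  "affine_gate_fun A F \<longleftrightarrow> (\<exists>f c. gate_fun A f \<and> F = (\<lambda>x. f x + c))"

lemma affine_gate_fun_proj: "a \<in> A \<Longrightarrow> affine_gate_fun A (\<lambda>x. x a)"
  unfolding affine_gate_fun_def by (intro exI[of _ "\<lambda>x. x a"] exI[of _ 0]) (auto intro: gate_fun.proj)

lemma affine_gate_fun_const: "A \<noteq> {} \<Longrightarrow> affine_gate_fun A (\<lambda>x. c)"
  unfolding affine_gate_fun_def by (intro exI[of _ "\<lambda>x. 0"] exI[of _ c]) (auto intro: gate_fun_zero)

lemma affine_gate_fun_add:
  assumes "affine_gate_fun A F" "affine_gate_fun A G"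
  shows "affine_gate_fun A (\<lambda>x. F x + G x)"
proof -
  from assms obtain f c g d where "gate_fun A f" "F = (\<lambda>x. f x + c)" "gate_fun A g" "G = (\<lambda>x. g x + d)"
    unfolding affine_gate_fun_def by blast
  then show ?thesis unfolding affine_gate_fun_def
    by (intro exI[of _ "\<lambda>x. f x + g x"] exI[of _ "c + d"]) (auto intro: gate_fun.add)
qed

lemma affine_gate_fun_sum:
  assumes "A \<noteq> {}" "\<And>s. s \<in> S \<Longrightarrow> affine_gate_fun A (F s)"
  shows "affine_gate_fun A (\<lambda>x. \<Sum>s\<in>S. F s x)"
  using assms(2)
proof (induction S rule: infinite_finite_induct)
  case (insert s S)
  then show ?case by (simp add: affine_gate_fun_add)
qed (simp_all add: affine_gate_fun_const assms(1))

text \<open>The constant \<open>c\<close> is divided with remainder: \<open>c mod l\<close> becomes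
  the initial state of an \<open>l\<close>-toppler and \<open>c div l\<close> the new constant. For
  \<open>l = 1\<close> division is the identity.\<close>

lemma affine_gate_fun_div:
  assumes "affine_gate_fun A F" "l \<ge> 1"
  shows "affine_gate_fun A (\<lambda>x. F x div l)"
proof (cases "l = 1")
  case False
  from assms obtain f c where f: "gate_fun A f" and F: "F = (\<lambda>x. f x + c)"
    unfolding affine_gate_fun_def by blast
  have "F x div l = (f x + c mod l) div l + c div l" for x
  proof -
    have "F x = (f x + c mod l) + (c div l) * l" by (simp add: F)
    then show ?thesis using assms(2) by (metis add.commute div_mult_self1 not_one_le_zero)
  qed
  moreover have "gate_fun A (\<lambda>x. (f x + c mod l) div l)"
    using f False assms(2) by (intro gate_fun.toppler) auto
  ultimately show ?thesis unfolding affine_gate_fun_def by blast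
qed (use assms in simp)

lemma affine_gate_fun_diff_1:
  assumes "affine_gate_fun A F"
  shows "affine_gate_fun A (\<lambda>x. F x - 1)"
proof -
  from assms obtain f c where f: "gate_fun A f" and F: "F = (\<lambda>x. f x + c)"
    unfolding affine_gate_fun_def by blast
  show ?thesis
  proof (cases c)
    case 0
    then show ?thesis unfolding affine_gate_fun_def F
      by (intro exI[of _ "\<lambda>x. f x - 1"] exI[of _ 0]) (auto intro: gate_fun.delayer[OF f, simplified])
  next
    case (Suc c')
    then show ?thesis unfolding affine_gate_fun_def F
      by (intro exI[of _ f] exI[of _ c']) (auto simp: f)
  qed
qed

lemma affine_gate_fun_min_1:
  assumes "A \<noteq> {}" "affine_gate_fun A F"
  shows "affine_gate_fun A (\<lambda>x. min (F x) 1)"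
proof -
  from assms obtain f c where f: "gate_fun A f" and F: "F = (\<lambda>x. f x + c)"
    unfolding affine_gate_fun_def by blast
  show ?thesis
  proof (cases c)
    case 0
    then show ?thesis unfolding affine_gate_fun_def F
      by (intro exI[of _ "\<lambda>x. min (f x) 1"] exI[of _ 0]) (auto intro: gate_fun.presink[OF f, simplified])
  next
    case (Suc c')
    then show ?thesis using affine_gate_fun_const[OF assms(1), of 1] by (simp add: F)
  qed
qed

lemma affine_gate_fun_diff: "affine_gate_fun A F \<Longrightarrow> affine_gate_fun A (\<lambda>x. F x - n)"
proof (induction n)
  case (Suc n)
  then show ?case using affine_gate_fun_diff_1[of A "\<lambda>x. F x - n"] by simp
qed simp

lemma affine_gate_fun_min:
  assumes "A \<noteq> {}" "affine_gate_fun A F"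
  shows "affine_gate_fun A (\<lambda>x. min (F x) n)"
proof -
  \<comment> \<open>The \<open>t\<close>-th summand is 1 exactly when \<open>y > t\<close>, so
    presinks behind chains of delayers count \<open>y\<close> up to \<open>n\<close>.\<close>
  have "min y n = (\<Sum>t<n. min (y - t) 1)" for y :: nat
  proof (induction n)
    case (Suc n)
    have "min y (Suc n) = min y n + min (y - n) 1" by (auto simp: min_def)
    with Suc show ?case by (simp only: sum.lessThan_Suc)
  qed simp
  then show ?thesis
    by (simp only:) (intro affine_gate_fun_sum affine_gate_fun_min_1 affine_gate_fun_diff assms)
qed


section \<open>Rounding identities\<close>

text \<open>Passing from \<open>y\<close> to \<open>y + 1\<close> shifts the summands by one place:
  \<open>y div m\<close> leaves the sum and \<open>(y + m) div m\<close>, larger by one,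
  enters.\<close>

lemma hermite_identity:
  fixes y m :: nat
  assumes "m \<ge> 1"
  shows "(\<Sum>j<m. (y + j) div m) = y"
proof (induction y)
  case 0
  show ?case by simp
next
  case (Suc y)
  have "(\<Sum>j<m. (y + Suc j) div m) + y div m = (\<Sum>j<Suc m. (y + j) div m)"
    by (subst sum.lessThan_Suc_shift) simp
  also have "\<dots> = y + (y div m + 1)"
    using Suc assms by (simp add: div_add_self2)
  finally show ?case by simp
qed

text \<open>If the jump happens at \<open>j\<close>, the sum is
  \<open>g 0 * (N + 1) + (N + 1 - j)\<close>, so adding \<open>n\<close> reaches the next multiple
  of \<open>N + 1\<close> exactly when \<open>n \<ge> j\<close>. Without a jump, adding
  \<open>n \<le> N\<close> never carries.\<close>

lemma div_sum_single_jump: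
  fixes g :: "nat \<Rightarrow> nat"
  assumes mono: "mono g" and jump: "g N \<le> g 0 + 1" and n: "n \<le> N"
  shows "((\<Sum>s\<le>N. g s) + n) div (N + 1) = g n"
proof -
  have lo: "g 0 \<le> g s" for s using mono by (simp add: monoD)
  have hi: "g s \<le> g 0 + 1" if "s \<le> N" for s
    using monoD[OF mono that] jump by simp
  have split: "(\<Sum>s\<le>N. g s) = (\<Sum>s<n. g s) + (\<Sum>s\<in>{n..N}. g s)"
    using n by (subst sum.union_disjoint[symmetric]) (auto intro!: sum.cong)
  have bounds: "g n * (N + 1) \<le> (\<Sum>s\<le>N. g s) + n \<and> (\<Sum>s\<le>N. g s) + n < g n * (N + 1) + (N + 1)"
  proof (cases "g n = g 0")
    case True
    have "(\<Sum>s\<le>N. g s) \<ge> (\<Sum>s\<le>N. g 0)" by (intro sum_mono lo)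
    moreover have "(\<Sum>s\<le>N. g s) \<le> (\<Sum>s\<le>N. g 0 + (if n < s then 1 else 0))"
    proof (intro sum_mono)
      fix s assume "s \<in> {..N}"
      then show "g s \<le> g 0 + (if n < s then 1 else 0)"
        using hi[of s] monoD[OF mono, of s n] True by (cases "n < s") auto
    qed
    moreover have "(\<Sum>s\<le>N. if n < s then 1 else 0 :: nat) = N - n"
    proof -
      have "{..N} \<inter> {s. n < s} = {n<..N}" by auto
      then show ?thesis by (simp add: sum.If_cases)
    qed
    ultimately show ?thesis using True n by (simp add: sum.distrib algebra_simps)
  next
    case False
    then have gn: "g n = g 0 + 1" using lo[of n] hi[OF n] by simp
    have "(\<Sum>s\<le>N. g s) \<le> (\<Sum>s\<le>N. g 0 + 1)" by (intro sum_mono hi) simp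
    moreover have "(\<Sum>s\<le>N. g s) \<ge> (\<Sum>s\<le>N. g 0 + (if n \<le> s then 1 else 0))"
    proof (intro sum_mono)
      fix s assume "s \<in> {..N}"
      then show "g s \<ge> g 0 + (if n \<le> s then 1 else 0)"
        using lo[of s] monoD[OF mono, of n s] gn by (cases "n \<le> s") auto
    qed
    moreover have "(\<Sum>s\<le>N. if n \<le> s then 1 else 0 :: nat) = N + 1 - n"
    proof -
      have "{..N} \<inter> {s. n \<le> s} = {n..N}" by auto
      then show ?thesis by (simp add: sum.If_cases)
    qed
    ultimately show ?thesis using gn n by (simp add: sum.distrib algebra_simps)
  qed
  show ?thesis
    by (rule div_nat_eqI) (use bounds in \<open>simp_all add: algebra_simps\<close>)
qed

text \<open>For \<open>n < l\<close> there is at most one jump within the period, which is the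
  preceding lemma. Adding \<open>l\<close> to \<open>n\<close> raises both sides by one.\<close>

lemma div_sum_period:
  fixes g :: "nat \<Rightarrow> nat"
  assumes mono: "mono g" and period: "\<And>n. g (n + l) = g n + 1" and l: "l \<ge> 1"
  shows "((\<Sum>s<l. g s) + n) div l = g n"
proof (induction n rule: less_induct)
  case (less n)
  show ?case
  proof (cases "n < l")
    case True
    obtain N where N: "l = Suc N" using l by (cases l) auto
    have "g N \<le> g 0 + 1" using period[of 0] monoD[OF mono, of N l] N by simp
    from div_sum_single_jump[OF mono this, of n] True N show ?thesis
      by (simp add: lessThan_Suc_atMost)
  next
    case False
    then have n: "n = (n - l) + l" by simp
    have "((\<Sum>s<l. g s) + n) div l = ((\<Sum>s<l. g s) + (n - l)) div l + 1"
      using l by (subst n) (simp add: div_add_self2 flip: add.assoc)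
    also have "\<dots> = g (n - l) + 1" using less[of "n - l"] False l by simp
    also have "\<dots> = g n" using period[of "n - l"] n by simp
    finally show ?thesis .
  qed
qed

text \<open>
  The first two summands are \<open>g (min n N)\<close> and \<open>g (max n N)\<close>; the remaining two together exceed
  \<open>g (max n N) - g N\<close> by \<open>0\<close> or \<open>1\<close>. Hence the dividend is \<open>2 * g n\<close> or \<open>2 * g n + 1\<close>.
\<close>

lemma div_sum_transient_period:
  fixes g :: "nat \<Rightarrow> nat"
  assumes mono: "mono g" and jump: "g N \<le> g 0 + 1"
    and period: "\<And>n. n \<ge> N \<Longrightarrow> g (n + l) = g n + 1" and l: "l \<ge> 1"
  shows "(((\<Sum>s\<le>N. g s) + min n N) div (N + 1) + ((\<Sum>s<l. g (N + s)) + (n - N)) div l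
           + ((n - N) div l + min (n - N) 1)) div 2 = g n"
proof -
  have mono': "mono (\<lambda>n. g (N + n))" using mono by (auto simp: mono_def)
  have A: "((\<Sum>s\<le>N. g s) + min n N) div (N + 1) = g (min n N)"
    by (rule div_sum_single_jump[OF mono jump]) simp
  have B: "((\<Sum>s<l. g (N + s)) + (n - N)) div l = g (N + (n - N))"
    by (rule div_sum_period[OF mono' _ l]) (use period in \<open>simp flip: add.assoc\<close>)
  show ?thesis
  proof (cases "n \<le> N")
    case True
    have "g 0 \<le> g n" "g n \<le> g N" using mono True by (simp_all add: monoD)
    then show ?thesis using A B jump True by simp
  next
    case False
    have it: "g (N + t * l) = g N + t" for t
    proof (induction t)
      case (Suc t)
      then show ?case using period[of "N + t * l"] by (simp add: add.commute add.left_commute)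
    qed simp
    \<comment> \<open>\<open>t\<close> counts the full periods beyond \<open>N\<close>; monotonicity
      traps \<open>g n\<close> between the values \<open>g N + t\<close> and
      \<open>g N + t + 1\<close> at the two ends of the current period.\<close>
    define t where "t = (n - N) div l"
    have "t * l \<le> n - N" by (simp add: t_def)
    then have "N + t * l \<le> n" using False by linarith
    moreover have "n < N + (t + 1) * l"
      using False l dividend_less_div_times[of l "n - N"] by (simp add: t_def)
    ultimately have "g N + t \<le> g n" "g n \<le> g N + (t + 1)"
      using monoD[OF mono, of "N + t * l" n] monoD[OF mono, of n "N + (t + 1) * l"]
      by (simp_all only: it)
    then have "g n = g N + t \<or> g n = g N + t + 1" by linarith
    moreover have "min (n - N) 1 = 1" "min n N = N" "N + (n - N) = n" using False by auto
    ultimately show ?thesis unfolding A B t_def[symmetric] by auto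
  qed
qed


section \<open>Monotone eventually linear-periodic functions\<close>

text \<open>One \<open>N\<close> is both transient length and period, as a large enough multiple of
  any period will serve. Arguments are total functions, so dependence on the coordinates in
  \<open>S\<close> alone is a clause of its own.\<close>

definition monotone_periodic :: "'a set \<Rightarrow> (('a \<Rightarrow> nat) \<Rightarrow> nat) \<Rightarrow> bool" where
  "monotone_periodic S F \<longleftrightarrow>
     (\<forall>x y. (\<forall>a\<in>S. x a = y a) \<longrightarrow> F x = F y) \<and>
     (\<exists>K. \<forall>i\<in>S. \<forall>x. F x \<le> F (x(i := Suc (x i))) \<and> F (x(i := Suc (x i))) \<le> F x + K) \<and>
     (\<forall>i\<in>S. \<exists>N\<ge>1. \<exists>d. \<forall>x. x i \<ge> N \<longrightarrow> F (x(i := x i + N)) = F x + d)"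

lemma monotone_periodic_restrict:
  assumes "monotone_periodic (insert k S) F" "k \<notin> S"
  shows "monotone_periodic S (\<lambda>x. F (x(k := s)))"
  unfolding monotone_periodic_def
proof (intro conjI)
  from assms(1) have dep: "\<And>x y. (\<forall>a\<in>insert k S. x a = y a) \<Longrightarrow> F x = F y"
    unfolding monotone_periodic_def by blast
  show "\<forall>x y. (\<forall>a\<in>S. x a = y a) \<longrightarrow> F (x(k := s)) = F (y(k := s))"
    by (auto intro!: dep)
  have swap: "x(i := n, k := s) = x(k := s, i := n)" if "i \<in> S" for x :: "'a \<Rightarrow> nat" and i n
    using that assms(2) by (auto simp: fun_eq_iff)
  have val: "x i = (x(k := s)) i" if "i \<in> S" for x :: "'a \<Rightarrow> nat" and i
    using that assms(2) by auto
  show "\<exists>K. \<forall>i\<in>S. \<forall>x. F (x(k := s)) \<le> F (x(i := Suc (x i), k := s)) \<and>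
      F (x(i := Suc (x i), k := s)) \<le> F (x(k := s)) + K"
  proof -
    from assms(1) obtain K where
      "\<forall>i\<in>insert k S. \<forall>x. F x \<le> F (x(i := Suc (x i))) \<and> F (x(i := Suc (x i))) \<le> F x + K"
      unfolding monotone_periodic_def by blast
    then show ?thesis using swap val by (intro exI[of _ K]) (metis insertI2)
  qed
  show "\<forall>i\<in>S. \<exists>N\<ge>1. \<exists>d. \<forall>x. N \<le> x i \<longrightarrow> F (x(i := x i + N, k := s)) = F (x(k := s)) + d"
  proof
    fix i assume i: "i \<in> S"
    with assms(1) obtain N d where "N \<ge> 1" "\<forall>x. x i \<ge> N \<longrightarrow> F (x(i := x i + N)) = F x + d"
      unfolding monotone_periodic_def by blast
    then show "\<exists>N\<ge>1. \<exists>d. \<forall>x. N \<le> x i \<longrightarrow> F (x(i := x i + N, k := s)) = F (x(k := s)) + d"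
      using swap[OF i] val[OF i] by metis
  qed
qed

text \<open>The period is enlarged from \<open>N\<close> to \<open>m * N\<close>: \<open>F\<close>
  then rises by \<open>m * d\<close>, a multiple of the divisor, so the quotient rises by exactly
  \<open>d\<close> whatever \<open>j\<close> is. Rounding preserves monotonicity and the increment
  bound \<open>K\<close>.\<close>

lemma monotone_periodic_div:
  assumes F: "monotone_periodic S F" and m: "m \<ge> 1"
  shows "monotone_periodic S (\<lambda>x. (F x + j) div m)"
  unfolding monotone_periodic_def
proof (intro conjI)
  show "\<forall>x y. (\<forall>a\<in>S. x a = y a) \<longrightarrow> (F x + j) div m = (F y + j) div m"
    using F unfolding monotone_periodic_def by metis
  from F obtain K where K:
    "\<forall>i\<in>S. \<forall>x. F x \<le> F (x(i := Suc (x i))) \<and> F (x(i := Suc (x i))) \<le> F x + K"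
    unfolding monotone_periodic_def by blast
  have "(y + j) div m \<le> (y' + j) div m \<and> (y' + j) div m \<le> (y + j) div m + K"
    if "y \<le> y'" "y' \<le> y + K" for y y'
  proof
    show "(y + j) div m \<le> (y' + j) div m" using that by (intro div_le_mono) simp
    have "K \<le> K * m" using m by simp
    then have "(y' + j) div m \<le> (y + j + K * m) div m" using that by (intro div_le_mono) linarith
    then show "(y' + j) div m \<le> (y + j) div m + K" using m by simp
  qed
  with K show "\<exists>K. \<forall>i\<in>S. \<forall>x. (F x + j) div m \<le> (F (x(i := Suc (x i))) + j) div m \<and>
      (F (x(i := Suc (x i))) + j) div m \<le> (F x + j) div m + K"
    by blast
  show "\<forall>i\<in>S. \<exists>N\<ge>1. \<exists>d. \<forall>x. N \<le> x i \<longrightarrow> (F (x(i := x i + N)) + j) div m = (F x + j) div m + d"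
  proof
    fix i assume i: "i \<in> S"
    with F obtain N d where N: "N \<ge> 1" "\<And>x. x i \<ge> N \<Longrightarrow> F (x(i := x i + N)) = F x + d"
      unfolding monotone_periodic_def by blast
    have it: "F (x(i := x i + t * N)) = F x + t * d" if "x i \<ge> N" for x t
    proof (induction t)
      case (Suc t)
      from N(2)[of "x(i := x i + t * N)", simplified] that Suc show ?case by (simp add: fun_upd_def add.commute add.left_commute)
    qed simp
    have "(F (x(i := x i + m * N)) + j) div m = (F x + j) div m + d" if "m * N \<le> x i" for x
    proof -
      have "N \<le> m * N" using m by simp
      then have "F (x(i := x i + m * N)) = F x + m * d" using it[of x m] that by linarith
      then have eq: "F (x(i := x i + m * N)) + j = (F x + j) + d * m" by simp
      show ?thesis unfolding eq using m by simp
    qed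
    moreover have "m * N \<ge> 1" using m N(1) by simp
    ultimately show "\<exists>N\<ge>1. \<exists>d. \<forall>x. N \<le> x i \<longrightarrow> (F (x(i := x i + N)) + j) div m = (F x + j) div m + d"
      by blast
  qed
qed

theorem affine_gate_fun_if_monotone_periodic:
  assumes "finite S" "S \<subseteq> A" "A \<noteq> {}" "monotone_periodic S F"
  shows "affine_gate_fun A F"
  using assms
proof (induction S arbitrary: F rule: finite_induct)
  case empty
  then have "F x = F (\<lambda>a. 0)" for x unfolding monotone_periodic_def by blast
  then have "F = (\<lambda>x. F (\<lambda>a. 0))" by blast
  then show ?case using affine_gate_fun_const[OF \<open>A \<noteq> {}\<close>] by metis
next
  case (insert k S)
  from insert.prems(3) obtain K where
    K: "\<And>x. F x \<le> F (x(k := Suc (x k))) \<and> F (x(k := Suc (x k))) \<le> F x + K"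
    unfolding monotone_periodic_def by blast
  from insert.prems(3) obtain N d where N: "N \<ge> 1"
    and d: "\<And>x. x k \<ge> N \<Longrightarrow> F (x(k := x k + N)) = F x + d"
    unfolding monotone_periodic_def by blast
  have step: "F (x(k := n)) \<le> F (x(k := Suc n))" for x n
    using K[of "x(k := n)"] by simp
  have bound: "F (x(k := n)) \<le> F (x(k := 0)) + n * K" for x n
  proof (induction n)
    case (Suc n)
    then show ?case using K[of "x(k := n)", simplified] by (simp add: fun_upd_def)
  qed simp
  \<comment> \<open>Two demands fix \<open>m\<close>: it is at least \<open>N * K\<close>, a bound
    on the rise of \<open>F\<close> while the \<open>k\<close>-th input runs from 0 to
    \<open>N\<close>, and for \<open>d > 0\<close> it is the exact rise of \<open>F\<close> over
    \<open>(K + 1) * N\<close> periods of length \<open>N\<close>. The factor 1 replaces a vanishing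
    \<open>d\<close>.\<close>
  define m where "m = (if d = 0 then 1 else d) * (K + 1) * N"
  have m: "m \<ge> 1" "N * K \<le> m"
  proof -
    show "m \<ge> 1" using N by (simp add: m_def)
    have "N * K \<le> 1 * ((K + 1) * N)" by simp
    also have "\<dots> \<le> (if d = 0 then 1 else d) * ((K + 1) * N)" by (intro mult_right_mono) auto
    finally show "N * K \<le> m" by (simp only: m_def mult.assoc)
  qed
  have "affine_gate_fun A (\<lambda>x. (F x + j) div m)" for j
  proof -
    define G where "G = (\<lambda>x. (F x + j) div m)"
    have G: "monotone_periodic (insert k S) G"
      unfolding G_def by (rule monotone_periodic_div[OF insert.prems(3) m(1)])
    \<comment> \<open>Slices of \<open>G\<close> depend only on the inputs in \<open>S\<close>, so
      the induction hypothesis covers them.\<close>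
    have slice: "affine_gate_fun A (\<lambda>x. G (x(k := s)))" for s
      using insert monotone_periodic_restrict[OF G] by auto
    have xk: "affine_gate_fun A (\<lambda>x. x k)" using insert.prems(1) by (auto intro: affine_gate_fun_proj)
    note closure = affine_gate_fun_div affine_gate_fun_add affine_gate_fun_sum
      affine_gate_fun_min affine_gate_fun_diff slice xk \<open>A \<noteq> {}\<close>
    have mono: "mono (\<lambda>n. G (x(k := n)))" for x
      unfolding mono_iff_le_Suc G_def using step by (auto intro!: div_le_mono)
    have jump: "G (x(k := N)) \<le> G (x(k := 0)) + 1" for x
    proof -
      have "G (x(k := N)) \<le> (F (x(k := 0)) + j + m) div m"
        unfolding G_def using bound[of x N] m by (intro div_le_mono) linarith
      then show ?thesis using div_add_self2[of m "F (x(k := 0)) + j"] m by (simp add: G_def)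
    qed
    show ?thesis
    proof (cases "d = 0")
      case True
      \<comment> \<open>With \<open>d = 0\<close>, \<open>F\<close> takes the same value at all
        \<open>k\<close>-coordinates \<open>N + t * N\<close>, so monotonicity makes
        \<open>G\<close> constant from \<open>N\<close> on.\<close>
      have "G (x(k := n)) = G (x(k := min n N))" for x n
      proof (cases "n \<le> N")
        case False
        have it: "F (x(k := N + t * N)) = F (x(k := N))" for t
        proof (induction t)
          case (Suc t)
          then show ?case using d[of "x(k := N + t * N)", simplified] True by (simp add: fun_upd_def add.commute add.left_commute)
        qed simp
        have "n \<le> N + n * N" using N by (simp add: trans_le_add2)
        then have "G (x(k := n)) \<le> G (x(k := N + n * N))" using monoD[OF mono] by blast
        moreover have "G (x(k := N)) \<le> G (x(k := n))" using monoD[OF mono] False by simp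
        ultimately show ?thesis using False it[of n] by (simp add: G_def min_def)
      qed simp
      from this[of _ "_ k"] have "G x = G (x(k := min (x k) N))" for x by (metis fun_upd_triv)
      then have "G x = ((\<Sum>s\<le>N. G (x(k := s))) + min (x k) N) div (N + 1)" for x
        by (subst div_sum_single_jump[OF mono jump]) simp_all
      then have "G = (\<lambda>x. ((\<Sum>s\<le>N. G (x(k := s))) + min (x k) N) div (N + 1))" by blast
      moreover have "affine_gate_fun A \<dots>" by (intro closure) auto
      ultimately show ?thesis unfolding G_def by simp
    next
      case False
      \<comment> \<open>These are \<open>(K + 1) * N\<close> periods of length \<open>N\<close>,
        over which \<open>F\<close> rises by exactly \<open>m\<close> and hence \<open>G\<close> by
        one.\<close>
      define l where "l = (K + 1) * N * N"
      have l: "l \<ge> 1" using N by (simp add: l_def)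
      have period: "G (x(k := n + l)) = G (x(k := n)) + 1" if "n \<ge> N" for x n
      proof -
        have it: "F (x(k := n + t * N)) = F (x(k := n)) + t * d" for t
        proof (induction t)
          case (Suc t)
          then show ?case using d[of "x(k := n + t * N)", simplified] that by (simp add: fun_upd_def add.commute add.left_commute)
        qed simp
        from it[of "(K + 1) * N"] have "F (x(k := n + l)) = F (x(k := n)) + m"
          using False by (simp add: l_def m_def algebra_simps)
        then have eq: "F (x(k := n + l)) + j = F (x(k := n)) + j + m" by simp
        show ?thesis unfolding G_def eq using m by (simp add: div_add_self2)
      qed
      have "G x = (((\<Sum>s\<le>N. G (x(k := s))) + min (x k) N) div (N + 1)
          + ((\<Sum>s<l. G (x(k := N + s))) + (x k - N)) div l
          + ((x k - N) div l + min (x k - N) 1)) div 2" for x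
        using div_sum_transient_period[OF mono jump period l, of x "x k"] by simp
      then have "G = (\<lambda>x. (((\<Sum>s\<le>N. G (x(k := s))) + min (x k) N) div (N + 1)
          + ((\<Sum>s<l. G (x(k := N + s))) + (x k - N)) div l
          + ((x k - N) div l + min (x k - N) 1)) div 2)" by blast
      moreover have "affine_gate_fun A \<dots>" by (intro closure l) auto
      ultimately show ?thesis unfolding G_def by simp
    qed
  qed
  then have "affine_gate_fun A (\<lambda>x. \<Sum>j<m. (F x + j) div m)"
    by (intro affine_gate_fun_sum \<open>A \<noteq> {}\<close>)
  then show ?case by (simp only: hermite_identity[OF m(1)])
qed


section \<open>Networks of letter-counting nodes\<close>

text \<open>
  For every gate, state and output are functions of the total number of letters received,
  irrespective of the input edges on which they arrived.
\<close>

definition counts_letters :: "('a, 'b, 'q) processor \<Rightarrow> (nat \<Rightarrow> nat) \<Rightarrow> (nat \<Rightarrow> 'q) \<Rightarrow> bool" where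
  "counts_letters P f st \<longleftrightarrow> f 0 = 0 \<and> st 0 = init P \<and>
     (\<forall>n. \<forall>i\<in>in_letters P. trans P i (st n) = st (Suc n) \<and>
        (\<forall>b\<in>out_letters P. f n + emit P i (st n) b = f (Suc n)))"

text \<open>\<open>V x e\<close> is the total number of letters ever placed on edge \<open>e\<close> on input \<open>x\<close>.\<close>

definition gate_network ::
    "(nat, nat, 's) network \<Rightarrow> ((nat \<Rightarrow> nat) \<Rightarrow> nat \<Rightarrow> nat) \<Rightarrow> bool" where
  "gate_network N V \<longleftrightarrow> abelian_network N \<and>
     (\<forall>e \<in> tailed_edges N \<inter> headed_edges N. tail N e < head N e) \<and>
     (\<forall>x. \<forall>e\<in>inputs N. V x e = x e) \<and>
     (\<forall>v\<in>nodes N. \<exists>f st. mono f \<and> counts_letters (proc N v) f st \<and>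
        (\<forall>x. \<forall>e\<in>out_edges N v. V x e = f (\<Sum>e'\<in>in_edges N v. V x e')))"

text \<open>The numbering of the nodes is a topological order.\<close>

lemma gate_network_acyclic:
  assumes "gate_network N V"
  shows "directed_acyclic N"
proof -
  have "{(tail N e, head N e) | e. e \<in> tailed_edges N \<inter> headed_edges N} \<subseteq> less_than"
    using assms by (auto simp: gate_network_def)
  then show ?thesis unfolding directed_acyclic_def
    by (rule acyclic_subset[rotated]) (simp add: wf_acyclic)
qed

text \<open>\<open>u e\<close> is the number of letters already taken from edge \<open>e\<close>.\<close>

definition odometer ::
    "(nat, nat, 's) network \<Rightarrow> (nat \<Rightarrow> nat \<Rightarrow> nat) \<Rightarrow> (nat \<Rightarrow> nat \<Rightarrow> 's) \<Rightarrow> (nat \<Rightarrow> nat)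
      \<Rightarrow> (nat \<Rightarrow> nat) \<Rightarrow> (nat, nat, 's) config \<Rightarrow> bool" where
  "odometer N f st x u c \<longleftrightarrow>
     (\<forall>e\<in>edges N. e \<notin> headed_edges N \<longrightarrow> u e = 0) \<and>
     (\<forall>e\<in>inputs N. fst c e + u e = x e) \<and>
     (\<forall>v\<in>nodes N. snd c v = st v (\<Sum>e\<in>in_edges N v. u e) \<and>
        (\<forall>e\<in>out_edges N v. fst c e + u e = f v (\<Sum>e'\<in>in_edges N v. u e')))"

lemma finite_in_edges: "abelian_network N \<Longrightarrow> finite (in_edges N v)"
  by (rule finite_subset[of _ "edges N"])
    (auto simp: abelian_network_def in_edges_def headed_edges_def)

lemma odometer_initial:
  assumes "abelian_network N" "\<forall>v\<in>nodes N. counts_letters (proc N v) (f v) (st v)"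
  shows "odometer N f st x (\<lambda>e. 0) (initial_config N x)"
  using assms unfolding odometer_def initial_config_def
  by (auto simp: counts_letters_def out_edges_def tailed_edges_def)

text \<open>Taking a letter from \<open>e\<close> moves one unit from the pile on \<open>e\<close>
  to \<open>u e\<close>, so pile plus \<open>u\<close> changes only on the outgoing edges of the
  fired node. There it grows by the emission, which is what \<open>f v\<close> gains from one more
  letter.\<close>

lemma odometer_fire:
  assumes N: "abelian_network N"
    and cl: "\<forall>v\<in>nodes N. counts_letters (proc N v) (f v) (st v)"
    and od: "odometer N f st x u c" and e: "e \<in> headed_edges N" and pos: "fst c e > 0"
  shows "odometer N f st x (u(e := Suc (u e))) (fire N e c)"
proof -
  define v where "v = head N e"
  define c' where "c' = fire N e c"
  have v: "v \<in> nodes N" and ev: "e \<in> in_edges N v"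
    using N e by (auto simp: abelian_network_def v_def in_edges_def)
  have P: "in_letters (proc N w) = in_edges N w" "out_letters (proc N w) = out_edges N w"
    if "w \<in> nodes N" for w
    using N that by (auto simp: abelian_network_def)
  have c'_fst: "fst c' e' = (if e' = e then fst c e' - 1 else fst c e') +
      (if e' \<in> out_edges N v then emit (proc N v) e (snd c v) e' else 0)" for e'
    by (simp add: c'_def fire_def Let_def v_def)
  have c'_snd: "snd c' = (snd c)(v := trans (proc N v) e (snd c v))"
    by (simp add: c'_def fire_def Let_def v_def)
  have sum_v: "(\<Sum>e'\<in>in_edges N v. (u(e := Suc (u e))) e') = Suc (\<Sum>e'\<in>in_edges N v. u e')"
    using ev finite_in_edges[OF N, of v] by (simp add: sum.remove[of _ e])
  have sum_w: "(\<Sum>e'\<in>in_edges N w. (u(e := Suc (u e))) e') = (\<Sum>e'\<in>in_edges N w. u e')"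
    if "w \<noteq> v" for w
    using that by (intro sum.cong) (auto simp: in_edges_def v_def)
  \<comment> \<open>The truncated \<open>m f - 1\<close> in \<open>fire\<close> is a true decrement
    because the pile on \<open>e\<close> is positive.\<close>
  have conserve: "fst c' e' + (u(e := Suc (u e))) e' = fst c e' + u e'"
    if "e' \<notin> out_edges N v" for e'
    using that pos by (simp add: c'_fst)
  have conserve': "fst c' e' + (u(e := Suc (u e))) e' =
      fst c e' + u e' + emit (proc N v) e (snd c v) e'"
    if "e' \<in> out_edges N v" for e'
    using that pos by (simp add: c'_fst)
  have st_v: "snd c v = st v (\<Sum>e\<in>in_edges N v. u e)"
    using od v by (auto simp: odometer_def)
  show ?thesis
    unfolding odometer_def c'_def[symmetric]
  proof (intro conjI ballI impI)
    fix e' assume "e' \<in> edges N" "e' \<notin> headed_edges N"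
    then show "(u(e := Suc (u e))) e' = 0" using od e by (auto simp: odometer_def)
  next
    fix e' assume e': "e' \<in> inputs N"
    then have "e' \<notin> out_edges N v" by (simp add: out_edges_def tailed_edges_def)
    then show "fst c' e' + (u(e := Suc (u e))) e' = x e'"
      using conserve od e' by (simp add: odometer_def)
  next
    fix w assume w: "w \<in> nodes N"
    show "snd c' w = st w (\<Sum>e'\<in>in_edges N w. (u(e := Suc (u e))) e')"
    proof (cases "w = v")
      case True
      then show ?thesis
        using cl v ev P[OF v] by (simp add: sum_v c'_snd st_v counts_letters_def del: fun_upd_apply) simp
    next
      case False
      then show ?thesis using od w by (simp add: sum_w c'_snd odometer_def del: fun_upd_apply) simp
    qed
    fix e' assume e': "e' \<in> out_edges N w"
    have "fst c e' + u e' = f w (\<Sum>e'\<in>in_edges N w. u e')"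
      using od w e' by (auto simp: odometer_def)
    then show "fst c' e' + (u(e := Suc (u e))) e' =
        f w (\<Sum>e'\<in>in_edges N w. (u(e := Suc (u e))) e')"
    proof (cases "w = v")
      case True
      have "f v (\<Sum>e\<in>in_edges N v. u e) + emit (proc N v) e (snd c v) e' =
          f v (Suc (\<Sum>e\<in>in_edges N v. u e))"
        using cl v ev P[OF v] e' True by (auto simp: counts_letters_def st_v)
      then show ?thesis using conserve' e' True \<open>fst c e' + u e' = _\<close> sum_v by metis
    next
      case False
      then have "e' \<notin> out_edges N v" using e' by (auto simp: out_edges_def)
      then show ?thesis using conserve sum_w[OF False] \<open>fst c e' + u e' = _\<close> by metis
    qed
  qed
qed

text \<open>Induction along the node numbering: if no more letters have been taken from the incoming
  edges than \<open>V\<close> predicts, monotonicity of \<open>f v\<close> bounds the outgoing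
  edges. In a halted configuration every letter on a headed edge has been taken, and the bounds
  become equalities.\<close>

lemma odometer_total:
  assumes gn: "gate_network N V"
    and mono: "\<forall>v\<in>nodes N. mono (f v)"
    and V: "\<forall>v\<in>nodes N. \<forall>e\<in>out_edges N v. V x e = f v (\<Sum>e'\<in>in_edges N v. V x e')"
    and od: "odometer N f st x u c"
  shows "e \<in> edges N \<Longrightarrow> fst c e + u e \<le> V x e"
    and "halted N c \<Longrightarrow> e \<in> edges N \<Longrightarrow> fst c e + u e = V x e"
proof -
  have tail: "tail N e \<in> nodes N \<and> e \<in> out_edges N (tail N e)" if "e \<in> edges N" "e \<notin> inputs N" for e
    using gn that by (auto simp: gate_network_def abelian_network_def tailed_edges_def out_edges_def)
  have inp: "fst c e + u e = V x e" if "e \<in> inputs N" for e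
    using od gn that by (simp add: odometer_def gate_network_def)
  have total: "fst c e + u e = f v (\<Sum>e'\<in>in_edges N v. u e')"
    if "v \<in> nodes N" "e \<in> out_edges N v" for v e
    using od that by (auto simp: odometer_def)
  have headed: "e' \<in> edges N \<and> e' \<in> headed_edges N \<and> (e' \<notin> inputs N \<longrightarrow> tail N e' < v)"
    if "e' \<in> in_edges N v" for e' v
    using gn that by (auto simp: gate_network_def in_edges_def headed_edges_def tailed_edges_def)
  have le: "\<forall>e\<in>out_edges N v. fst c e + u e \<le> V x e" if "v \<in> nodes N" for v
    using that
  proof (induction v rule: less_induct)
    case (less v)
    have "u e' \<le> V x e'" if "e' \<in> in_edges N v" for e'
    proof (cases "e' \<in> inputs N")
      case True
      then show ?thesis using inp[of e'] by simp
    next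
      case False
      then show ?thesis using less.IH[of "tail N e'"] tail headed[OF that]
        by (meson add_leD2)
    qed
    then have "(\<Sum>e'\<in>in_edges N v. u e') \<le> (\<Sum>e'\<in>in_edges N v. V x e')" by (rule sum_mono)
    then show ?case using total[OF less.prems] V mono less.prems by (auto simp: monoD)
  qed
  then show "fst c e + u e \<le> V x e" if "e \<in> edges N"
    using that inp tail by (metis order_refl)
  have eq: "\<forall>e\<in>out_edges N v. fst c e + u e = V x e" if h: "halted N c" and "v \<in> nodes N" for v
    using that(2)
  proof (induction v rule: less_induct)
    case (less v)
    have "u e' = V x e'" if "e' \<in> in_edges N v" for e'
    proof -
      have "fst c e' = 0" using h headed[OF that] by (simp add: halted_def)
      then show ?thesis
        using inp[of e'] less.IH[of "tail N e'"] tail[of e'] headed[OF that]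
        by (metis add_0)
    qed
    then have "(\<Sum>e'\<in>in_edges N v. u e') = (\<Sum>e'\<in>in_edges N v. V x e')" by (rule sum.cong[OF refl])
    then show ?case using total[OF less.prems] V less.prems by simp
  qed
  then show "fst c e + u e = V x e" if "halted N c" "e \<in> edges N"
    using that inp tail by metis
qed

text \<open>Each step raises the sum of \<open>u\<close> over the headed edges by one, while
  \<open>odometer_total\<close> caps it, so no run is infinite. Nothing is ever taken from an output
  edge, so its final pile is the full total.\<close>

theorem gate_network_computes:
  assumes gn: "gate_network N V"
  shows "network_computes N V"
  unfolding network_computes_def
proof (rule allI, rule conjI)
  fix x
  have N: "abelian_network N" using gn by (simp add: gate_network_def)
  from gn have "\<forall>v\<in>nodes N. \<exists>f. \<exists>st. mono f \<and> counts_letters (proc N v) f st \<and>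
        (\<forall>x. \<forall>e\<in>out_edges N v. V x e = f (\<Sum>e'\<in>in_edges N v. V x e'))"
    by (simp add: gate_network_def)
  then obtain f where "\<forall>v\<in>nodes N. \<exists>st. mono (f v) \<and> counts_letters (proc N v) (f v) st \<and>
        (\<forall>x. \<forall>e\<in>out_edges N v. V x e = f v (\<Sum>e'\<in>in_edges N v. V x e'))"
    by (rule bchoice[THEN exE])
  then obtain st where f: "\<forall>v\<in>nodes N. mono (f v) \<and> counts_letters (proc N v) (f v) (st v) \<and>
        (\<forall>x. \<forall>e\<in>out_edges N v. V x e = f v (\<Sum>e'\<in>in_edges N v. V x e'))"
    by (rule bchoice[THEN exE])
  then have cl: "\<forall>v\<in>nodes N. counts_letters (proc N v) (f v) (st v)"
    and mono: "\<forall>v\<in>nodes N. mono (f v)"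
    and V: "\<forall>v\<in>nodes N. \<forall>e\<in>out_edges N v. V x e = f v (\<Sum>e'\<in>in_edges N v. V x e')"
    by auto
  have fin: "finite (headed_edges N)" and sub: "headed_edges N \<subseteq> edges N"
    using N by (auto simp: abelian_network_def headed_edges_def)
  have step_od: "\<exists>u'. odometer N f st x u' c' \<and>
      (\<Sum>e\<in>headed_edges N. u' e) = Suc (\<Sum>e\<in>headed_edges N. u e)"
    if "odometer N f st x u c" "step N c c'" for u c c'
  proof -
    from that(2) obtain e where e: "e \<in> headed_edges N" "fst c e > 0" "c' = fire N e c"
      unfolding step_def by blast
    have "(\<Sum>e'\<in>headed_edges N. (u(e := Suc (u e))) e') = Suc (\<Sum>e'\<in>headed_edges N. u e')"
      using e(1) fin by (simp add: sum.remove[of _ e])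
    then show ?thesis using odometer_fire[OF N cl that(1) e(1,2)] e(3) by blast
  qed
  show "halts_on N x"
    unfolding halts_on_def
  proof
    assume "\<exists>r. r 0 = initial_config N x \<and> (\<forall>k. step N (r k) (r (Suc k)))"
    then obtain r where r: "r 0 = initial_config N x" "\<And>k. step N (r k) (r (Suc k))" by blast
    have "\<exists>u. odometer N f st x u (r k) \<and> (\<Sum>e\<in>headed_edges N. u e) = k" for k
    proof (induction k)
      case 0
      then show ?case using odometer_initial[OF N cl, of x] r(1) by (intro exI[of _ "\<lambda>e. 0"]) simp
    next
      case (Suc k)
      then show ?case using step_od[OF _ r(2)] by metis
    qed
    \<comment> \<open>The run is inspected one step after the cap.\<close>
    then obtain u where u: "odometer N f st x u (r (Suc (\<Sum>e\<in>headed_edges N. V x e)))"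
      "(\<Sum>e\<in>headed_edges N. u e) = Suc (\<Sum>e\<in>headed_edges N. V x e)"
      by blast
    have "(\<Sum>e\<in>headed_edges N. u e) \<le> (\<Sum>e\<in>headed_edges N. V x e)"
      using odometer_total(1)[OF gn mono V u(1)] sub by (intro sum_mono) (meson add_leD2 subsetD)
    then show False using u(2) by simp
  qed
  show "\<forall>c. (step N)\<^sup>*\<^sup>* (initial_config N x) c \<and> halted N c \<longrightarrow> (\<forall>e\<in>outputs N. fst c e = V x e)"
  proof (intro allI impI ballI)
    fix c e assume c: "(step N)\<^sup>*\<^sup>* (initial_config N x) c \<and> halted N c" and e: "e \<in> outputs N"
    from c have "(step N)\<^sup>*\<^sup>* (initial_config N x) c" by simp
    then have "\<exists>u. odometer N f st x u c"
    proof (induction rule: rtranclp_induct)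
      case base
      then show ?case using odometer_initial[OF N cl] by blast
    next
      case (step c c')
      then show ?case using step_od by blast
    qed
    then obtain u where u: "odometer N f st x u c" by blast
    have "e \<in> edges N" "e \<notin> headed_edges N" using N e by (auto simp: abelian_network_def headed_edges_def)
    then show "fst c e = V x e"
      using odometer_total(2)[OF gn mono V u, of e] c u by (simp add: odometer_def)
  qed
qed


section \<open>Attaching gates to output edges\<close>

definition attach ::
    "(nat, nat, 's) network \<Rightarrow> nat \<Rightarrow> (nat, nat, 's) processor \<Rightarrow> (nat, nat, 's) network" where
  "attach N v P = N\<lparr>nodes := insert v (nodes N), edges := edges N \<union> out_letters P,
     outputs := (outputs N - in_letters P) \<union> out_letters P,
     tail := \<lambda>e. if e \<in> out_letters P then v else tail N e,
     head := \<lambda>e. if e \<in> in_letters P then v else head N e,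
     proc := (proc N)(v := P)\<rparr>"

text \<open>A node number above all others keeps every edge increasing, and fresh output edges
  cannot feed back into \<open>N\<close>, so the totals on the old edges are unaffected.\<close>

lemma gate_network_attach:
  assumes gn: "gate_network N V" and v: "\<forall>w\<in>nodes N. w < v"
    and P: "finite_processor P" "abelian P" "mono f" "counts_letters P f st"
    and I: "in_letters P \<subseteq> outputs N" and O: "out_letters P \<inter> edges N = {}"
  shows "gate_network (attach N v P)
    (\<lambda>x e. if e \<in> out_letters P then f (\<Sum>e'\<in>in_letters P. V x e') else V x e)"
    (is "gate_network ?N ?V")
proof -
  have N: "abelian_network N" using gn by (simp add: gate_network_def)
  have sub: "inputs N \<subseteq> edges N" "outputs N \<subseteq> edges N" "trash N \<subseteq> edges N"
    and disj: "inputs N \<inter> outputs N = {}" "outputs N \<inter> trash N = {}"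
    and tl: "\<And>e. e \<in> tailed_edges N \<Longrightarrow> tail N e \<in> nodes N"
    and hd: "\<And>e. e \<in> headed_edges N \<Longrightarrow> head N e \<in> nodes N"
    using N by (auto simp: abelian_network_def)
  have vN: "v \<notin> nodes N" using v by blast
  have headed: "headed_edges ?N = headed_edges N \<union> in_letters P"
    using sub disj I O by (auto simp: headed_edges_def attach_def)
  have tailed: "tailed_edges ?N = tailed_edges N \<union> out_letters P"
    using sub O by (auto simp: tailed_edges_def attach_def)
  have in_v: "in_edges ?N v = in_letters P"
    unfolding in_edges_def headed using hd vN by (auto simp: attach_def)
  have in_w: "in_edges ?N w = in_edges N w" if "w \<noteq> v" for w
    unfolding in_edges_def headed using that I by (auto simp: attach_def headed_edges_def)
  have out_v: "out_edges ?N v = out_letters P"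
    unfolding out_edges_def tailed using tl vN by (auto simp: attach_def)
  have out_w: "out_edges ?N w = out_edges N w" if "w \<noteq> v" for w
    unfolding out_edges_def tailed using that O by (auto simp: attach_def tailed_edges_def)
  have abelian: "abelian_network ?N"
    unfolding abelian_network_def
  proof (intro conjI)
    show "\<forall>e\<in>tailed_edges ?N. tail ?N e \<in> nodes ?N"
      unfolding tailed using tl by (auto simp: attach_def)
    show "\<forall>e\<in>headed_edges ?N. head ?N e \<in> nodes ?N"
      unfolding headed using hd by (auto simp: attach_def)
    show "\<forall>w\<in>nodes ?N. finite_processor (proc ?N w) \<and> Defs.abelian (proc ?N w) \<and>
        in_letters (proc ?N w) = in_edges ?N w \<and> out_letters (proc ?N w) = out_edges ?N w"
    proof
      fix w assume w: "w \<in> nodes ?N"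
      show "finite_processor (proc ?N w) \<and> Defs.abelian (proc ?N w) \<and>
        in_letters (proc ?N w) = in_edges ?N w \<and> out_letters (proc ?N w) = out_edges ?N w"
      proof (cases "w = v")
        case True
        then show ?thesis using P in_v out_v by (simp add: attach_def)
      next
        case False
        then have "w \<in> nodes N" "proc ?N w = proc N w" using w by (auto simp: attach_def)
        then show ?thesis using N in_w[OF False] out_w[OF False] by (simp add: abelian_network_def)
      qed
    qed
  qed (use N P(1) I O sub disj in \<open>auto simp: attach_def abelian_network_def finite_processor_def\<close>)
  have old: "e \<notin> out_letters P" if "e \<in> edges N" for e using that O by blast
  show ?thesis
    unfolding gate_network_def
  proof (intro conjI ballI allI)
    fix e assume e: "e \<in> tailed_edges ?N \<inter> headed_edges ?N"
    then have "e \<in> headed_edges N \<union> in_letters P" by (simp add: headed)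
    then have eN: "e \<in> edges N" using I sub by (auto simp: headed_edges_def)
    with e have t: "e \<in> tailed_edges N" using O by (auto simp: tailed)
    show "tail ?N e < head ?N e"
    proof (cases "e \<in> in_letters P")
      case True
      then show ?thesis using tl[OF t] v old[OF eN] by (simp add: attach_def)
    next
      case False
      then show ?thesis using e t gn old[OF eN] by (simp add: attach_def gate_network_def headed[unfolded attach_def])
    qed
  next
    fix x e assume "e \<in> inputs ?N"
    then have "e \<in> inputs N" by (simp add: attach_def)
    then show "?V x e = x e" using gn old sub by (auto simp: gate_network_def)
  next
    fix w assume w: "w \<in> nodes ?N"
    have V_in: "(\<Sum>e'\<in>in_edges ?N w. ?V x e') = (\<Sum>e'\<in>in_edges ?N w. V x e')" for x
    proof (rule sum.cong[OF refl])
      fix e' assume "e' \<in> in_edges ?N w"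
      then have "e' \<in> headed_edges N \<union> in_letters P" by (simp add: in_edges_def headed)
      then have "e' \<in> edges N" using I sub by (auto simp: headed_edges_def)
      then show "?V x e' = V x e'" using old by simp
    qed
    show "\<exists>f st. mono f \<and> counts_letters (proc ?N w) f st \<and>
        (\<forall>x. \<forall>e\<in>out_edges ?N w. ?V x e = f (\<Sum>e'\<in>in_edges ?N w. ?V x e'))"
    proof (cases "w = v")
      case True
      then have "proc ?N w = P" by (simp add: attach_def)
      then show ?thesis unfolding V_in using True P(3,4) in_v out_v by (intro exI[of _ f] exI[of _ st]) simp
    next
      case False
      then have w: "w \<in> nodes N" and proc: "proc ?N w = proc N w" using w by (auto simp: attach_def)
      have "?V x e = V x e" if "e \<in> out_edges N w" for x e
        using that old by (auto simp: out_edges_def tailed_edges_def)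
      then show ?thesis unfolding V_in unfolding in_w[OF False] out_w[OF False] proc
        using gn w by (simp add: gate_network_def)
    qed
  qed (rule abelian)
qed

text \<open>Output and trash edges alike have no head, so the dynamics stay the same and the edge
  merely ceases to be read.\<close>

lemma gate_network_trash:
  assumes gn: "gate_network N V" and e: "e \<in> outputs N"
  shows "gate_network (N\<lparr>outputs := outputs N - {e}, trash := insert e (trash N)\<rparr>) V"
    (is "gate_network ?N V")
proof -
  have eqs: "headed_edges ?N = headed_edges N" "tailed_edges ?N = tailed_edges N"
    using e by (auto simp: headed_edges_def tailed_edges_def)
  then have "in_edges ?N = in_edges N" "out_edges ?N = out_edges N"
    by (auto simp: fun_eq_iff in_edges_def out_edges_def)
  then show ?thesis
    using gn e unfolding gate_network_def abelian_network_def eqs by auto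
qed


section \<open>Gates as processors that only count letters\<close>

definition gate_with :: "nat set \<Rightarrow> nat set \<Rightarrow> (nat \<Rightarrow> nat) \<Rightarrow> bool" where
  "gate_with I U f \<longleftrightarrow> (\<exists>(P :: (nat, nat, nat) processor) st.
     is_gate P \<and> finite_processor P \<and> abelian P \<and> in_letters P = I \<and> out_letters P = U \<and>
     mono f \<and> counts_letters P f st)"

text \<open>No gate distinguishes its input letters, and a splitter emits equally on both outputs,
  so one transition and one emission count describe all five kinds; commutation is then
  automatic.\<close>

definition counting_processor ::
    "'a set \<Rightarrow> 'b set \<Rightarrow> 'q set \<Rightarrow> 'q \<Rightarrow> ('q \<Rightarrow> 'q) \<Rightarrow> ('q \<Rightarrow> nat) \<Rightarrow> ('a, 'b, 'q) processor" where
  "counting_processor I U Q q0 \<delta> \<epsilon> = \<lparr>in_letters = I, out_letters = U, states = Q, init = q0,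
     trans = \<lambda>_. \<delta>, emit = \<lambda>_ q _. \<epsilon> q\<rparr>"

lemma gate_withI:
  assumes "is_gate (counting_processor I U Q q0 \<delta> \<epsilon> :: (nat, nat, nat) processor)"
    and "finite I" "finite U" "finite Q" "q0 \<in> Q" "\<And>q. q \<in> Q \<Longrightarrow> \<delta> q \<in> Q"
    and "st 0 = q0" "\<And>n. st (Suc n) = \<delta> (st n)" "f 0 = 0" "\<And>n. f (Suc n) = f n + \<epsilon> (st n)"
  shows "gate_with I U f"
proof -
  have "mono f" by (simp add: mono_iff_le_Suc assms(10))
  moreover have "counts_letters (counting_processor I U Q q0 \<delta> \<epsilon>) f st"
    using assms by (simp add: counts_letters_def counting_processor_def)
  moreover have "finite_processor (counting_processor I U Q q0 \<delta> \<epsilon>)"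
    using assms by (simp add: finite_processor_def counting_processor_def)
  moreover have "abelian (counting_processor I U Q q0 \<delta> \<epsilon>)"
    by (simp add: abelian_def counting_processor_def)
  ultimately show ?thesis
    unfolding gate_with_def using assms(1)
    by (intro exI[of _ "counting_processor I U Q q0 \<delta> \<epsilon>"] exI[of _ st])
      (simp add: counting_processor_def)
qed

lemma gate_with_adder:
  assumes "i \<noteq> j"
  shows "gate_with {i, j} {b} (\<lambda>n. n)"
proof (rule gate_withI[where Q = "{0}" and ?q0.0 = 0 and \<delta> = "\<lambda>_. 0" and \<epsilon> = "\<lambda>_. 1" and st = "\<lambda>_. 0"])
  have "is_adder (counting_processor {i, j} {b} {0} 0 (\<lambda>_. 0) (\<lambda>_. 1))"
    unfolding is_adder_def by (intro exI[of _ i] exI[of _ j] exI[of _ b])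
      (use assms in \<open>simp add: counting_processor_def\<close>)
  then show "is_gate (counting_processor {i, j} {b} {0} 0 (\<lambda>_. 0) (\<lambda>_. 1))"
    by (simp add: is_gate_def)
qed simp_all

lemma gate_with_splitter:
  assumes "b \<noteq> c"
  shows "gate_with {i} {b, c} (\<lambda>n. n)"
proof (rule gate_withI[where Q = "{0}" and ?q0.0 = 0 and \<delta> = "\<lambda>_. 0" and \<epsilon> = "\<lambda>_. 1" and st = "\<lambda>_. 0"])
  have "is_splitter (counting_processor {i} {b, c} {0} 0 (\<lambda>_. 0) (\<lambda>_. 1))"
    unfolding is_splitter_def by (intro exI[of _ i] exI[of _ b] exI[of _ c])
      (use assms in \<open>simp add: counting_processor_def\<close>)
  then show "is_gate (counting_processor {i} {b, c} {0} 0 (\<lambda>_. 0) (\<lambda>_. 1))"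
    by (simp add: is_gate_def)
qed simp_all

text \<open>After \<open>n\<close> letters the state is \<open>(n + q) mod l\<close>; the quotient
  rises precisely when this residue wraps to 0.\<close>

lemma gate_with_toppler:
  assumes l: "2 \<le> l" and q: "q < l"
  shows "gate_with {i} {b} (\<lambda>n. (n + q) div l)"
proof (rule gate_withI[where Q = "{..<l}" and ?q0.0 = q and \<delta> = "\<lambda>q. Suc q mod l"
      and \<epsilon> = "\<lambda>q. if Suc q = l then 1 else 0" and st = "\<lambda>n. (n + q) mod l"])
  let ?P = "counting_processor {i} {b} {..<l} q (\<lambda>q. Suc q mod l) (\<lambda>q. if Suc q = l then 1 else 0)"
  have "is_toppler ?P"
    unfolding is_toppler_def
    by (intro exI[of _ l] conjI l exI[of _ i] exI[of _ b])
      (use l q in \<open>auto simp: counting_processor_def\<close>)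
  then show "is_gate ?P" by (simp add: is_gate_def)
  show "(Suc n + q) mod l = Suc ((n + q) mod l) mod l" for n by (simp add: mod_Suc_eq)
  show "(Suc n + q) div l = (n + q) div l + (if Suc ((n + q) mod l) = l then 1 else 0)" for n
    by (simp add: div_Suc mod_Suc)
qed (use l q in simp_all)

lemma
  shows gate_with_delayer: "gate_with {i} {b} (\<lambda>n. n - 1)"
    and gate_with_primed_delayer: "gate_with {i} {b} (\<lambda>n. n)"
proof -
  have "is_delayer (counting_processor {i} {b} {0, 1} q0 (\<lambda>_. 1) (\<lambda>q. q))" if "q0 \<in> {0, 1}" for q0
    unfolding is_delayer_def by (intro exI[of _ i] exI[of _ b])
      (use that in \<open>simp add: counting_processor_def\<close>)
  then have gate: "is_gate (counting_processor {i} {b} {0, 1} q0 (\<lambda>_. 1) (\<lambda>q. q))"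
    if "q0 \<in> {0, 1}" for q0
    using that by (simp add: is_gate_def)
  show "gate_with {i} {b} (\<lambda>n. n - 1)"
    by (rule gate_withI[OF gate, of 0 "\<lambda>n. min n 1"]) auto
  show "gate_with {i} {b} (\<lambda>n. n)"
    by (rule gate_withI[OF gate, of 1 "\<lambda>_. 1"]) auto
qed

lemma gate_with_presink: "gate_with {i} {b} (\<lambda>n. min n 1)"
proof (rule gate_withI[where Q = "{0, 1}" and ?q0.0 = 0 and \<delta> = "\<lambda>_. 1" and \<epsilon> = "\<lambda>q. 1 - q"
      and st = "\<lambda>n. min n 1"])
  have "is_presink (counting_processor {i} {b} {0, 1} 0 (\<lambda>_. 1) (\<lambda>q. 1 - q))"
    unfolding is_presink_def by (intro exI[of _ i] exI[of _ b]) (simp add: counting_processor_def)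
  then show "is_gate (counting_processor {i} {b} {0, 1} 0 (\<lambda>_. 1) (\<lambda>q. 1 - q))"
    by (simp add: is_gate_def)
qed auto


section \<open>Realizing gate functions by networks\<close>

text \<open>A multiset of output functions forgets edge names but records how many output edges
  carry the same function, so that gates act on outputs as on interchangeable tokens.\<close>

definition realizable :: "nat set \<Rightarrow> ((nat \<Rightarrow> nat) \<Rightarrow> nat) multiset \<Rightarrow> bool" where
  "realizable I M \<longleftrightarrow> (\<exists>(N :: (nat, nat, nat) network) V. gate_network N V \<and>
     (\<forall>v\<in>nodes N. is_gate (proc N v)) \<and> inputs N = I \<and>
     image_mset (\<lambda>e x. V x e) (mset_set (outputs N)) = M)"

lemma finite_outputs: "gate_network N V \<Longrightarrow> finite (outputs N)"
  by (auto simp: gate_network_def abelian_network_def intro: finite_subset)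

lemma realizable_attach:
  assumes gn: "gate_network N V" and gates: "\<forall>v\<in>nodes N. is_gate (proc N v)"
    and J: "J \<subseteq> outputs N" and U: "finite U" "U \<inter> edges N = {}" and P: "gate_with J U f"
  shows "realizable (inputs N) (replicate_mset (card U) (\<lambda>x. f (\<Sum>e\<in>J. V x e)) +
    image_mset (\<lambda>e x. V x e) (mset_set (outputs N - J)))"
proof -
  from P obtain P :: "(nat, nat, nat) processor" and st where
    P: "is_gate P" "finite_processor P" "abelian P" "mono f" "counts_letters P f st"
    and letters: "in_letters P = J" "out_letters P = U"
    unfolding gate_with_def by blast
  have "finite (nodes N)" using gn by (simp add: gate_network_def abelian_network_def)
  then obtain v where v: "\<forall>w\<in>nodes N. w < v" by (auto simp: finite_nat_set_iff_bounded)
  let ?V = "\<lambda>x e. if e \<in> U then f (\<Sum>e'\<in>J. V x e') else V x e"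
  have gn': "gate_network (attach N v P) ?V"
    using gate_network_attach[OF gn v P(2-5)] J U unfolding letters by simp
  have sub: "outputs N \<subseteq> edges N" using gn by (simp add: gate_network_def abelian_network_def)
  have "mset_set (outputs (attach N v P)) = mset_set U + mset_set (outputs N - J)"
    using sub U finite_outputs[OF gn] letters
    by (subst mset_set_Union[symmetric]) (auto simp: attach_def Un_commute)
  moreover have "image_mset (\<lambda>e x. ?V x e) (mset_set U) = replicate_mset (card U) (\<lambda>x. f (\<Sum>e\<in>J. V x e))"
  proof -
    have "image_mset (\<lambda>e x. ?V x e) (mset_set U) =
        image_mset (\<lambda>e x. f (\<Sum>e\<in>J. V x e)) (mset_set U)"
      using U by (intro image_mset_cong) (auto simp: fun_eq_iff)
    then show ?thesis by (simp add: image_mset_const_eq)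
  qed
  moreover have "image_mset (\<lambda>e x. ?V x e) (mset_set (outputs N - J)) =
      image_mset (\<lambda>e x. V x e) (mset_set (outputs N - J))"
    using sub U finite_outputs[OF gn] by (intro image_mset_cong) (auto simp: fun_eq_iff)
  ultimately have "image_mset (\<lambda>e x. ?V x e) (mset_set (outputs (attach N v P))) =
      replicate_mset (card U) (\<lambda>x. f (\<Sum>e\<in>J. V x e)) +
      image_mset (\<lambda>e x. V x e) (mset_set (outputs N - J))"
    by simp
  moreover have "\<forall>w\<in>nodes (attach N v P). is_gate (proc (attach N v P) w)"
    using gates P(1) by (simp add: attach_def)
  moreover have "inputs (attach N v P) = inputs N" by (simp add: attach_def)
  ultimately show ?thesis unfolding realizable_def using gn' by blast
qed

lemma realizable_add_msetE:
  assumes "realizable I (add_mset g M)"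
  obtains N :: "(nat, nat, nat) network" and V e where "gate_network N V"
    "\<forall>v\<in>nodes N. is_gate (proc N v)" "inputs N = I" "e \<in> outputs N" "(\<lambda>x. V x e) = g"
    "image_mset (\<lambda>e x. V x e) (mset_set (outputs N - {e})) = M"
proof -
  from assms obtain N :: "(nat, nat, nat) network" and V where N: "gate_network N V"
    "\<forall>v\<in>nodes N. is_gate (proc N v)" "inputs N = I"
    and M: "image_mset (\<lambda>e x. V x e) (mset_set (outputs N)) = add_mset g M"
    unfolding realizable_def by blast
  from msed_map_invR[OF M] obtain M' e where e: "mset_set (outputs N) = add_mset e M'"
    "(\<lambda>x. V x e) = g" "image_mset (\<lambda>e x. V x e) M' = M"
    by blast
  have "e \<in># mset_set (outputs N)" by (simp add: e(1))
  then have eo: "e \<in> outputs N" using finite_outputs[OF N(1)] by simp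
  have "mset_set (outputs N - {e}) = M'"
    using e(1) eo finite_outputs[OF N(1)] by (simp add: mset_set_Diff)
  then show ?thesis using that N e eo by blast
qed

lemma ex_fresh_edge:
  assumes "gate_network N V"
  obtains b :: nat where "b \<notin> edges N" and "b \<noteq> a"
proof -
  have "finite (insert a (edges N))" using assms by (simp add: gate_network_def abelian_network_def)
  then show ?thesis using ex_new_if_finite[OF infinite_UNIV_nat] that by blast
qed

lemma realizable_unary:
  assumes "realizable I (add_mset g M)" and f: "\<And>i b. gate_with {i} {b} f"
  shows "realizable I (add_mset (\<lambda>x. f (g x)) M)"
  using assms(1)
proof (rule realizable_add_msetE)
  fix N :: "(nat, nat, nat) network" and V e
  assume N: "gate_network N V" "\<forall>v\<in>nodes N. is_gate (proc N v)" "inputs N = I" "e \<in> outputs N"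
    "(\<lambda>x. V x e) = g" "image_mset (\<lambda>e x. V x e) (mset_set (outputs N - {e})) = M"
  obtain b where "b \<notin> edges N" by (rule ex_fresh_edge[OF N(1)])
  with realizable_attach[OF N(1,2) _ _ _ f[of e b]] N show ?thesis by (auto simp: fun_eq_iff)
qed

lemma realizable_split:
  assumes "realizable I (add_mset g M)"
  shows "realizable I (add_mset g (add_mset g M))"
  using assms
proof (rule realizable_add_msetE)
  fix N :: "(nat, nat, nat) network" and V e
  assume N: "gate_network N V" "\<forall>v\<in>nodes N. is_gate (proc N v)" "inputs N = I" "e \<in> outputs N"
    "(\<lambda>x. V x e) = g" "image_mset (\<lambda>e x. V x e) (mset_set (outputs N - {e})) = M"
  obtain b where b: "b \<notin> edges N" by (rule ex_fresh_edge[OF N(1)])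
  obtain c where c: "c \<notin> edges N" "c \<noteq> b" by (rule ex_fresh_edge[OF N(1)])
  have "replicate_mset (card {b, c}) g = {#g, g#}" using c by simp
  with realizable_attach[OF N(1,2) _ _ _ gate_with_splitter[of b c e]] b c N show ?thesis
    by auto
qed

lemma realizable_plus:
  assumes "realizable I (add_mset g (add_mset h M))"
  shows "realizable I (add_mset (\<lambda>x. g x + h x) M)"
  using assms
proof (rule realizable_add_msetE)
  fix N :: "(nat, nat, nat) network" and V e
  assume N: "gate_network N V" "\<forall>v\<in>nodes N. is_gate (proc N v)" "inputs N = I" "e \<in> outputs N"
    "(\<lambda>x. V x e) = g" "image_mset (\<lambda>e x. V x e) (mset_set (outputs N - {e})) = add_mset h M"
  from msed_map_invR[OF N(6)] obtain M' e' where e': "mset_set (outputs N - {e}) = add_mset e' M'"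
    "(\<lambda>x. V x e') = h" "image_mset (\<lambda>e x. V x e) M' = M"
    by blast
  have "e' \<in># mset_set (outputs N - {e})" by (simp add: e'(1))
  \<comment> \<open>\<open>e'\<close> comes from the outputs other than \<open>e\<close>, so the
    adder gets two distinct edges even when \<open>g = h\<close>.\<close>
  then have eo: "e' \<in> outputs N - {e}" using finite_outputs[OF N(1)] by simp
  have "mset_set (outputs N - {e, e'}) = mset_set (outputs N - {e} - {e'})"
    by (simp add: insert_commute flip: Diff_insert)
  also have "\<dots> = M'"
    using e'(1) eo finite_outputs[OF N(1)] by (simp add: mset_set_Diff)
  finally have M': "image_mset (\<lambda>e x. V x e) (mset_set (outputs N - {e, e'})) = M" using e' by simp
  obtain b where "b \<notin> edges N" by (rule ex_fresh_edge[OF N(1)])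
  moreover have "(\<lambda>x. \<Sum>e\<in>{e, e'}. V x e) = (\<lambda>x. g x + h x)"
    using eo N(5) e'(2) by (auto simp: fun_eq_iff)
  ultimately show ?thesis
    using realizable_attach[OF N(1,2) _ _ _ gate_with_adder[of e e' b]] M' N(3,4) eo by auto
qed

lemma realizable_trash:
  assumes "realizable I (add_mset g M)"
  shows "realizable I M"
  using assms
proof (rule realizable_add_msetE)
  fix N :: "(nat, nat, nat) network" and V e
  assume N: "gate_network N V" "\<forall>v\<in>nodes N. is_gate (proc N v)" "inputs N = I" "e \<in> outputs N"
    "(\<lambda>x. V x e) = g" "image_mset (\<lambda>e x. V x e) (mset_set (outputs N - {e})) = M"
  show ?thesis
    unfolding realizable_def using gate_network_trash[OF N(1,4)] N(2,3,6)
    by (intro exI[of _ "N\<lparr>outputs := outputs N - {e}, trash := insert e (trash N)\<rparr>"] exI[of _ V]) simp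
qed

abbreviation projections :: "nat set \<Rightarrow> ((nat \<Rightarrow> nat) \<Rightarrow> nat) multiset" where
  "projections I \<equiv> image_mset (\<lambda>i x. x i) (mset_set I)"

text \<open>
  Input edges cannot be output edges, so each input passes through a node that acts as the
  identity: a delayer started in state \<open>1\<close>.
\<close>

lemma realizable_projections: "realizable {..<k} (projections {..<k})"
proof -
  have "\<exists>(P :: (nat, nat, nat) processor) st. is_gate P \<and> finite_processor P \<and> abelian P \<and>
      in_letters P = {i} \<and> out_letters P = {i + k} \<and> mono (\<lambda>n :: nat. n) \<and> counts_letters P (\<lambda>n. n) st" for i
    using gate_with_primed_delayer[of i "i + k"] by (simp add: gate_with_def)
  then obtain P :: "nat \<Rightarrow> (nat, nat, nat) processor" and st where
    P: "\<And>i. is_gate (P i)" "\<And>i. finite_processor (P i)" "\<And>i. abelian (P i)"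
    "\<And>i. in_letters (P i) = {i}" "\<And>i. out_letters (P i) = {i + k}"
    "\<And>i. counts_letters (P i) (\<lambda>n. n) (st i)"
    by metis
  \<comment> \<open>Node \<open>i\<close> has the single input edge \<open>i\<close> and the single
    output edge \<open>i + k\<close>; no edge joins two nodes.\<close>
  define N where "N = \<lparr>nodes = {..<k}, edges = {..<k + k}, inputs = {..<k}, outputs = {k..<k + k},
    trash = {}, tail = \<lambda>e. e - k, head = \<lambda>e. e, proc = P\<rparr>"
  let ?V = "\<lambda>x e. if e < k then x e else x (e - k) :: nat"
  have in_N: "in_edges N i = {i}" if "i < k" for i
    using that by (auto simp: N_def in_edges_def headed_edges_def)
  have out_N: "out_edges N i = {i + k}" if "i < k" for i
    using that by (auto simp: N_def out_edges_def tailed_edges_def)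
  have "abelian_network N"
    unfolding abelian_network_def using P in_N out_N
    by (auto simp: N_def tailed_edges_def headed_edges_def)
  moreover have "tailed_edges N \<inter> headed_edges N = {}"
    by (auto simp: N_def tailed_edges_def headed_edges_def)
  moreover have "\<forall>v\<in>nodes N. \<exists>f st. mono f \<and> counts_letters (proc N v) f st \<and>
      (\<forall>x. \<forall>e\<in>out_edges N v. ?V x e = f (\<Sum>e'\<in>in_edges N v. ?V x e'))"
  proof
    fix v assume "v \<in> nodes N"
    then have "v < k" "proc N v = P v" by (simp_all add: N_def)
    then show "\<exists>f st. mono f \<and> counts_letters (proc N v) f st \<and>
      (\<forall>x. \<forall>e\<in>out_edges N v. ?V x e = f (\<Sum>e'\<in>in_edges N v. ?V x e'))"
      using P(6)[of v] in_N out_N by (intro exI[of _ "\<lambda>n. n"] exI[of _ "st v"]) (simp add: mono_def)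
  qed
  moreover have "\<forall>x. \<forall>e\<in>inputs N. ?V x e = x e" by (simp add: N_def)
  ultimately have gn: "gate_network N ?V" by (simp add: gate_network_def)
  have "outputs N = (\<lambda>i. i + k) ` {..<k}"
    by (simp add: N_def image_add_atLeastLessThan' lessThan_atLeast0)
  then have "mset_set (outputs N) = image_mset (\<lambda>i. i + k) (mset_set {..<k})"
    by (simp add: image_mset_mset_set)
  then have "image_mset (\<lambda>e x. ?V x e) (mset_set (outputs N)) = projections {..<k}"
    by (simp add: multiset.map_comp comp_def)
  then show ?thesis
    unfolding realizable_def using gn P(1) by (intro exI[of _ N] exI[of _ ?V]) (simp add: N_def)
qed

text \<open>Keeping all projections among the outputs is the invariant that allows inputs to be
  reused: a projection is split before one copy is consumed. Generality of \<open>M\<close> lets the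
  first summand wait there while the second is built.\<close>

lemma realizable_gate_fun:
  assumes "gate_fun I F" "finite I" "realizable I (M + projections I)"
  shows "realizable I (add_mset F (M + projections I))"
  using assms(1,3)
proof (induction arbitrary: M rule: gate_fun.induct)
  case (proj i)
  then have "projections I = add_mset (\<lambda>x. x i) (projections (I - {i}))"
    using assms(2) by (simp add: mset_set.remove)
  with proj realizable_split show ?case by (metis union_mset_add_mset_right)
next
  case (add f g)
  from add.IH(2)[of "add_mset f M"] add.IH(1)[OF add.prems]
  have "realizable I (add_mset f (add_mset g (M + projections I)))"
    by (simp add: add_mset_commute)
  then show ?case by (rule realizable_plus)
next
  case (toppler f l q)
  then show ?case using realizable_unary[OF _ gate_with_toppler] by blast
next
  case (delayer f)
  then show ?case using realizable_unary[OF _ gate_with_delayer] by blast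
next
  case (presink f)
  then show ?case using realizable_unary[OF _ gate_with_presink] by blast
qed

lemma realizable_gate_funs:
  assumes "finite B" "\<And>b. b \<in> B \<Longrightarrow> gate_fun {..<k} (F b)"
  shows "realizable {..<k} (image_mset F (mset_set B))"
proof -
  have *: "realizable {..<k} (image_mset F (mset_set B) + projections {..<k})"
    using assms
  proof (induction B rule: finite_induct)
    case empty
    then show ?case using realizable_projections by simp
  next
    case (insert b B)
    then show ?case using realizable_gate_fun[of "{..<k}" "F b"] by simp
  qed
  have "realizable I (M + M') \<Longrightarrow> realizable I M" for I M M'
    by (induction M') (auto dest: realizable_trash)
  \<comment> \<open>The projections left over are sent to trash.\<close>
  with * show ?thesis by blast
qed

text \<open>This recovers the identification of output letters with output edges from the equality
  of their multisets of functions: a letter is paired with an edge of equal value and both are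
  removed.\<close>

lemma bij_betw_if_image_mset_eq:
  assumes "finite B" "finite S" "image_mset h (mset_set S) = image_mset g (mset_set B)"
  shows "\<exists>\<omega>. bij_betw \<omega> B S \<and> (\<forall>b\<in>B. h (\<omega> b) = g b)"
  using assms
proof (induction B arbitrary: S rule: finite_induct)
  case empty
  then have "S = {}" by (simp add: mset_set_empty_iff)
  then show ?case by (simp add: bij_betw_def)
next
  case (insert b B)
  then have eq: "image_mset h (mset_set S) = add_mset (g b) (image_mset g (mset_set B))" by simp
  from msed_map_invR[OF eq] obtain M' e where e: "mset_set S = add_mset e M'" "h e = g b"
    "image_mset h M' = image_mset g (mset_set B)"
    by blast
  have "e \<in># mset_set S" by (simp add: e(1))
  then have eS: "e \<in> S" using insert.prems(1) by simp
  then have "mset_set (S - {e}) = M'" using e(1) insert.prems(1) by (simp add: mset_set_Diff)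
  then obtain \<omega> where \<omega>: "bij_betw \<omega> B (S - {e})" "\<forall>b\<in>B. h (\<omega> b) = g b"
    using insert.IH[of "S - {e}"] insert.prems(1) e(3) by auto
  have "bij_betw (\<omega>(b := e)) B (S - {e})"
    using \<omega>(1) insert.hyps(2) by (subst bij_betw_cong[of B _ \<omega>]) auto
  then have "bij_betw (\<omega>(b := e)) (B \<union> {b}) ((S - {e}) \<union> {e})"
    using insert.hyps(2) by (intro bij_betw_combine) (auto simp: bij_betw_def)
  then have "bij_betw (\<omega>(b := e)) (insert b B) S" using eS by (simp add: insert_absorb)
  moreover have "\<forall>b'\<in>insert b B. h ((\<omega>(b := e)) b') = g b'"
    using \<omega>(2) e(2) insert.hyps(2) by auto
  ultimately show ?case by blast
qed


section \<open>The function computed by a finite abelian processor\<close>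

lemma word_output_append:
  "word_output P q (u @ v) b = word_output P q u b + word_output P (fold (trans P) u q) v b"
  by (induction u arbitrary: q) auto

lemma fold_trans_in_states:
  assumes "finite_processor P"
  shows "set w \<subseteq> in_letters P \<Longrightarrow> q \<in> states P \<Longrightarrow> fold (trans P) w q \<in> states P"
  using assms by (induction w arbitrary: q) (auto simp: finite_processor_def)

lemma fold_replicate: "fold t (replicate n i) = t i ^^ n"
  by (induction n) (auto simp: funpow_swap1)

context
  fixes P :: "('a, 'b, 'q) processor"
  assumes fin: "finite_processor P" and ab: "abelian P"
begin

text \<open>The abelian law exchanges \<open>i\<close> with one letter, and induction carries it
  across \<open>u\<close>. Equality of the end states is included so that every continuation yields
  the same output too.\<close>

lemma word_rotate1:
  assumes "set u \<subseteq> in_letters P" "i \<in> in_letters P" "q \<in> states P" "b \<in> out_letters P"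
  shows "fold (trans P) (u @ [i]) q = fold (trans P) (i # u) q \<and>
    word_output P q (u @ [i]) b = word_output P q (i # u) b"
  using assms
proof (induction u arbitrary: q)
  case (Cons j u)
  have t: "trans P j q \<in> states P" using Cons.prems fin by (simp add: finite_processor_def)
  have "trans P i (trans P j q) = trans P j (trans P i q)"
    "emit P i q b + emit P j (trans P i q) b = emit P j q b + emit P i (trans P j q) b"
    using Cons.prems ab by (simp_all add: abelian_def)
  then show ?case using Cons.IH[OF _ Cons.prems(2) t Cons.prems(4)] Cons.prems by simp
qed simp

text \<open>The first letter of \<open>w\<close> is rotated to the front of \<open>w'\<close>, after
  which both words continue from the same state with equal multisets.\<close>

lemma word_output_permute:
  assumes "set w \<subseteq> in_letters P" "mset w = mset w'" "q \<in> states P" "b \<in> out_letters P"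
  shows "word_output P q w b = word_output P q w' b"
  using assms
proof (induction w arbitrary: w' q)
  case (Cons i w)
  then have "i \<in> set w'" by (metis list.set_intros(1) set_mset_mset)
  then obtain u v where w': "w' = u @ i # v" by (meson split_list)
  then have w: "mset w = mset (u @ v)" using Cons.prems(2) by simp
  have sub: "set u \<subseteq> in_letters P" "i \<in> in_letters P"
    using Cons.prems(1,2) w' by (metis mset_eq_setD set_append le_sup_iff) (use Cons.prems in simp)
  have t: "trans P i q \<in> states P" using Cons.prems fin by (simp add: finite_processor_def)
  have "word_output P q w' b = word_output P q ((u @ [i]) @ v) b" by (simp add: w')
  also have "\<dots> = word_output P q ((i # u) @ v) b"
    using word_rotate1[OF sub Cons.prems(3,4)] by (simp only: word_output_append[of P q _ v])
  also have "\<dots> = word_output P q (i # w) b"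
    using Cons.IH[OF _ w t Cons.prems(4)] Cons.prems(1) by simp
  finally show ?case by simp
qed simp

text \<open>An arbitrary ordering of the letters is chosen; \<open>word_output_permute\<close> makes
  the choice immaterial for the output.\<close>

definition word_of :: "('a \<Rightarrow> nat) \<Rightarrow> 'a list" where
  "word_of x = (SOME w. set w \<subseteq> in_letters P \<and> (\<forall>a\<in>in_letters P. count (mset w) a = x a))"

definition function_of :: "'b \<Rightarrow> ('a \<Rightarrow> nat) \<Rightarrow> nat" where
  "function_of b x = word_output P (init P) (word_of x) b"

lemma word_of: "set (word_of x) \<subseteq> in_letters P" "\<And>a. a \<in> in_letters P \<Longrightarrow> count (mset (word_of x)) a = x a"
proof -
  have "\<exists>w. set w \<subseteq> A \<and> (\<forall>a\<in>A. count (mset w) a = x a)" if "finite A" for A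
    using that
  proof (induction A rule: finite_induct)
    case (insert a A)
    then obtain w where w: "set w \<subseteq> A" "\<forall>a\<in>A. count (mset w) a = x a" by blast
    then have "count (mset w) a = 0" using insert.hyps(2) by (auto simp: count_eq_zero_iff)
    with w insert.hyps(2) show ?case
      by (intro exI[of _ "replicate (x a) a @ w"]) auto
  qed simp
  moreover have "finite (in_letters P)" using fin by (simp add: finite_processor_def)
  ultimately have "\<exists>w. set w \<subseteq> in_letters P \<and> (\<forall>a\<in>in_letters P. count (mset w) a = x a)" by blast
  from someI_ex[OF this] show "set (word_of x) \<subseteq> in_letters P"
    "\<And>a. a \<in> in_letters P \<Longrightarrow> count (mset (word_of x)) a = x a"
    unfolding word_of_def by blast+
qed

lemma init_in_states: "init P \<in> states P"
  using fin by (simp add: finite_processor_def)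

lemma function_of_eq:
  assumes "set w \<subseteq> in_letters P" "\<And>a. a \<in> in_letters P \<Longrightarrow> count (mset w) a = x a" "b \<in> out_letters P"
  shows "function_of b x = word_output P (init P) w b"
proof -
  have "mset (word_of x) = mset w"
  proof (rule multiset_eqI)
    fix a
    show "count (mset (word_of x)) a = count (mset w) a"
    proof (cases "a \<in> in_letters P")
      case False
      then have "a \<notin> set (word_of x)" "a \<notin> set w" using word_of(1) assms(1) by auto
      then show ?thesis by (simp add: count_eq_zero_iff[THEN iffD2])
    qed (simp add: word_of(2) assms(2))
  qed
  then show ?thesis
    unfolding function_of_def using word_output_permute[OF word_of(1) _ init_in_states assms(3)] by blast
qed

lemma processor_computes_function_of: "processor_computes P (\<lambda>x b. function_of b x)"
  unfolding processor_computes_def by (auto intro!: function_of_eq simp: count_mset)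

text \<open>On a finite state set two powers of \<open>trans P i\<close> agree, say at exponents
  \<open>m\<close> and \<open>m + p\<close>. Any positive multiple of \<open>p\<close> that is at
  least \<open>m\<close> can then serve as \<open>N\<close>; the proof takes
  \<open>(m + 1) * p\<close>.\<close>

lemma trans_eventually_periodic:
  assumes i: "i \<in> in_letters P"
  obtains N where "N \<ge> 1" "\<And>q. q \<in> states P \<Longrightarrow> (trans P i ^^ (N + N)) q = (trans P i ^^ N) q"
proof -
  let ?t = "trans P i" and ?Q = "states P"
  have closed: "(?t ^^ n) q \<in> ?Q" if "q \<in> ?Q" for n q
    using that fin i by (induction n) (auto simp: finite_processor_def)
  \<comment> \<open>Restriction to the states gives a finite function space,
    \<open>trans P i\<close> being arbitrary elsewhere.\<close>
  have "range (\<lambda>n. restrict (?t ^^ n) ?Q) \<subseteq> ?Q \<rightarrow>\<^sub>E ?Q" using closed by auto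
  moreover have "finite (?Q \<rightarrow>\<^sub>E ?Q)" using fin by (auto simp: finite_processor_def intro: finite_PiE)
  ultimately have "finite (range (\<lambda>n. restrict (?t ^^ n) ?Q))" by (rule finite_subset)
  then have "\<not> inj (\<lambda>n. restrict (?t ^^ n) ?Q)" using finite_imageD infinite_UNIV_nat by blast
  then obtain m n where "m < n" and eq: "restrict (?t ^^ m) ?Q = restrict (?t ^^ n) ?Q"
    unfolding inj_def by (metis linorder_neqE_nat)
  then obtain p where p: "p \<ge> 1" "n = m + p" by (metis less_imp_add_positive Suc_leI One_nat_def)
  have m: "(?t ^^ (m + p)) q = (?t ^^ m) q" if "q \<in> ?Q" for q
    using fun_cong[OF eq, of q] that p by simp
  have shift: "(?t ^^ (a + p)) q = (?t ^^ a) q" if "q \<in> ?Q" "m \<le> a" for a q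
  proof -
    have "(?t ^^ (a + p)) q = (?t ^^ (a - m)) ((?t ^^ (m + p)) q)"
      using that by (simp flip: funpow_add[THEN fun_cong, unfolded comp_apply])
    also have "\<dots> = (?t ^^ (a - m)) ((?t ^^ m) q)" using m that by simp
    also have "\<dots> = (?t ^^ a) q"
      using that by (simp flip: funpow_add[THEN fun_cong, unfolded comp_apply])
    finally show ?thesis .
  qed
  have it: "(?t ^^ (a + c * p)) q = (?t ^^ a) q" if "q \<in> ?Q" "m \<le> a" for a c q
  proof (induction c)
    case (Suc c)
    have "(?t ^^ (a + Suc c * p)) q = (?t ^^ ((a + c * p) + p)) q" by (simp add: ac_simps)
    also have "\<dots> = (?t ^^ (a + c * p)) q" using that by (intro shift) simp_all
    finally show ?case using Suc by simp
  qed simp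
  have "m \<le> (m + 1) * p" using p(1) by (cases p) auto
  then show ?thesis using it[of _ "(m + 1) * p" "m + 1"] p(1) by (intro that[of "(m + 1) * p"]) auto
qed

lemma monotone_periodic_function_of:
  assumes b: "b \<in> out_letters P"
  shows "monotone_periodic (in_letters P) (function_of b)"
  unfolding monotone_periodic_def
proof (intro conjI)
  have "word_of x = word_of y" if "\<forall>a\<in>in_letters P. x a = y a" for x y
    unfolding word_of_def using that by (metis (lifting))
  then show "\<forall>x y. (\<forall>a\<in>in_letters P. x a = y a) \<longrightarrow> function_of b x = function_of b y"
    unfolding function_of_def by metis
  define K where "K = (\<Sum>(i, q)\<in>in_letters P \<times> states P. emit P i q b)"
  have K: "emit P i q b \<le> K" if "i \<in> in_letters P" "q \<in> states P" for i q
    using member_le_sum[of "(i, q)" "in_letters P \<times> states P" "\<lambda>(i, q). emit P i q b"] that fin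
    by (simp add: K_def finite_processor_def)
  have step: "\<exists>q\<in>states P. function_of b (x(i := Suc (x i))) = function_of b x + emit P i q b"
    if i: "i \<in> in_letters P" for i x
  proof
    show "fold (trans P) (word_of x) (init P) \<in> states P"
      using fold_trans_in_states[OF fin word_of(1) init_in_states] .
    have "function_of b (x(i := Suc (x i))) = word_output P (init P) (word_of x @ [i]) b"
      using word_of i b by (intro function_of_eq) auto
    then show "function_of b (x(i := Suc (x i))) =
        function_of b x + emit P i (fold (trans P) (word_of x) (init P)) b"
      by (simp add: word_output_append function_of_def)
  qed
  show "\<exists>K. \<forall>i\<in>in_letters P. \<forall>x. function_of b x \<le> function_of b (x(i := Suc (x i))) \<and>
      function_of b (x(i := Suc (x i))) \<le> function_of b x + K"
  proof (intro exI[of _ K] ballI allI)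
    fix i x assume i: "i \<in> in_letters P"
    from step[OF this, of x] K[OF i] show "function_of b x \<le> function_of b (x(i := Suc (x i))) \<and>
      function_of b (x(i := Suc (x i))) \<le> function_of b x + K" by force
  qed
  show "\<forall>i\<in>in_letters P. \<exists>N\<ge>1. \<exists>d. \<forall>x. N \<le> x i \<longrightarrow>
      function_of b (x(i := x i + N)) = function_of b x + d"
  proof
    fix i assume i: "i \<in> in_letters P"
    obtain N where N: "N \<ge> 1"
      "\<And>q. q \<in> states P \<Longrightarrow> (trans P i ^^ (N + N)) q = (trans P i ^^ N) q"
      by (rule trans_eventually_periodic[OF i]) blast
    \<comment> \<open>After \<open>N\<close> letters \<open>i\<close> the state \<open>?q\<close>
      recurs under \<open>N\<close> further ones, so an inserted second block emits
      \<open>?d\<close> and leaves the same state for the remaining letters.\<close>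
    let ?q = "(trans P i ^^ N) (init P)"
    let ?d = "word_output P ?q (replicate N i) b"
    have "function_of b (x(i := x i + N)) = function_of b x + ?d" if x: "N \<le> x i" for x
    proof -
      define v where "v = word_of (x(i := x i - N))"
      have v: "set v \<subseteq> in_letters P" "\<And>a. a \<in> in_letters P \<Longrightarrow> count (mset v) a = (x(i := x i - N)) a"
        unfolding v_def by (rule word_of, erule word_of)
      have "function_of b x = word_output P (init P) (replicate N i @ v) b"
        using v i b x by (intro function_of_eq) auto
      moreover have "function_of b (x(i := x i + N)) =
          word_output P (init P) (replicate N i @ replicate N i @ v) b"
        using v i b x by (intro function_of_eq) auto
      moreover have "(trans P i ^^ N) ?q = ?q"
        using N(2)[OF init_in_states] by (simp add: funpow_add)
      ultimately show ?thesis by (simp add: word_output_append fold_replicate)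
    qed
    then show "\<exists>N\<ge>1. \<exists>d. \<forall>x. N \<le> x i \<longrightarrow> function_of b (x(i := x i + N)) = function_of b x + d"
      using N(1) by blast
  qed
qed

text \<open>No input yields no output, and gate functions vanish at zero, so the additive constant
  must be 0.\<close>

lemma gate_fun_function_of:
  assumes b: "b \<in> out_letters P" and "in_letters P \<noteq> {}"
  shows "gate_fun (in_letters P) (function_of b)"
proof -
  have "affine_gate_fun (in_letters P) (function_of b)"
    using affine_gate_fun_if_monotone_periodic[OF _ _ assms(2) monotone_periodic_function_of[OF b]] fin
    by (simp add: finite_processor_def)
  then obtain f c where f: "gate_fun (in_letters P) f" "function_of b = (\<lambda>x. f x + c)"
    unfolding affine_gate_fun_def by blast
  have "function_of b (\<lambda>a. 0) = 0" using function_of_eq[of "[]" "\<lambda>a. 0" b] b by simp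
  then show ?thesis using f gate_fun_at_zero[OF f(1)] by simp
qed

end

theorem theorem1p1:
  fixes P :: "('a, 'b, 'q) processor"
  assumes "finite_processor P" and "abelian P" and "accessible P" and "nondegenerate P"
  shows "\<exists>N :: (nat, nat, nat) network.
           abelian_network N \<and> directed_acyclic N \<and>
           (\<forall>v\<in>nodes N. is_gate (proc N v)) \<and> emulates N P"
proof -
  note fin = assms(1) and ab = assms(2)
  have finite: "finite (in_letters P)" "finite (out_letters P)"
    using fin by (simp_all add: finite_processor_def)
  then obtain \<iota> where \<iota>: "bij_betw \<iota> (in_letters P) {..<card (in_letters P)}"
    using ex_bij_betw_finite_nat by (metis lessThan_atLeast0)
  define F where "F = (\<lambda>b x. function_of P b (x \<circ> \<iota>))"
  have "gate_fun {..<card (in_letters P)} (F b)" if b: "b \<in> out_letters P" for b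
  proof -
    \<comment> \<open>Given an output letter, nondegeneracy supplies an input letter, from which
      constants are built.\<close>
    have "in_letters P \<noteq> {}" using assms(4) b by (auto simp: nondegenerate_def)
    from gate_fun_reindex[OF gate_fun_function_of[OF fin ab b this], of \<iota>] \<iota>
    show ?thesis by (simp add: F_def bij_betw_def)
  qed
  then have "realizable {..<card (in_letters P)} (image_mset F (mset_set (out_letters P)))"
    by (intro realizable_gate_funs finite)
  then obtain N :: "(nat, nat, nat) network" and V where gn: "gate_network N V"
    and gates: "\<forall>v\<in>nodes N. is_gate (proc N v)" and inp: "inputs N = {..<card (in_letters P)}"
    and out: "image_mset (\<lambda>e x. V x e) (mset_set (outputs N)) = image_mset F (mset_set (out_letters P))"
    unfolding realizable_def by blast
  from bij_betw_if_image_mset_eq[OF finite(2) finite_outputs[OF gn] out] obtain \<omega> where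
    \<omega>: "bij_betw \<omega> (out_letters P) (outputs N)" "\<forall>b\<in>out_letters P. (\<lambda>x. V x (\<omega> b)) = F b"
    by blast
  have "emulates N P"
    unfolding emulates_def
  proof (intro exI conjI)
    show "bij_betw \<iota> (in_letters P) (inputs N)" using \<iota> inp by simp
    show "processor_computes P (\<lambda>x b. function_of P b x)"
      by (rule processor_computes_function_of[OF fin ab])
    show "network_computes N V" by (rule gate_network_computes[OF gn])
    show "\<forall>x. \<forall>b\<in>out_letters P. V x (\<omega> b) = function_of P b (x \<circ> \<iota>)"
      using \<omega>(2) unfolding F_def by (metis (lifting))
  qed (rule \<omega>(1))
  moreover have "abelian_network N" using gn by (simp add: gate_network_def)
  ultimately show ?thesis using gates gate_network_acyclic[OF gn] by blast
qed

end
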